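(* Let $d\ge1$ and let $\mathscr P_{\le d}$ be the set of all P-modules over $\mathbb C^d$. The tensor product defines a Lie group action $\alpha_d$ of $\mathrm{Irr}_{\mathrm{diff}}(1)$ on $\mathscr P_{\le d}$ by $$(a,b,\mathbb C)\cdot(A,B,\mathbb C^d):=(a,b,\mathbb C)\boxtimes(A,B,\mathbb C^d)=(aAK^{-1},bBK^{-1},\mathbb C^d)=(e^{i\mathrm{Arg}(a)}U_A\circ(|a|\star|A|),\ e^{i\mathrm{Arg}(b)}U_B\circ(|b|\star|B|),\ \mathbb C^d)$$ where $\mathrm{Arg}$ is any argument function and $K=\sqrt{|a|^2|A|^2+|b|^2|B|^2}$. Moreover, $\alpha_d$ restricts to an action on $\mathcal M\cap\mathscr P_{\le d}$ and on $\mathcal N\cap\mathscr P_{\le d}$.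
   Context: A P-module over $\mathbb C^d$ is a triple $(A,B,\mathbb C^d)$ with $A,B$ complex $d\times d$ matrices satisfying $A^*A+B^*B=\mathrm{id}$. $\mathcal M$ (resp. $\mathcal N$) is the class of finite-dimensional P-modules with $A$ normal (resp. normal and invertible) and $B$ invertible. $\mathrm{Irr}_{\mathrm{diff}}(1)=\{(a,b,\mathbb C):|a|^2+|b|^2=1,\ a\ne0\ne b\}$ is an abelian Lie group (with the smooth structure of an open subset of the unit sphere of $\mathbb C^2$) under $\boxtimes$, with identity $(1/\sqrt2,1/\sqrt2,\mathbb C)$. When $\ker(A\otimes\tilde A)\cap\ker(B\otimes\tilde B)=\{0\}$, the tensor product of P-modules is $(A,B,\mathfrak H)\boxtimes(\tilde A,\tilde B,\tilde{\mathfrak H}):=((A\otimes\tilde A)K^{-1},(B\otimes\tilde B)K^{-1},\mathfrak H\otimes\tilde{\mathfrak H})$ with $K:=\sqrt{|A|^2\otimes|\tilde A|^2+|B|^2\otimes|\tilde B|^2}$; $\mathbb C\otimes\mathbb C^d$ is identified with $\mathbb C^d$. $T=U_T|T|$ denotes any polar decomposition with $U_T$ unitary and $|T|=(T^*T)^{1/2}$. For operators $0\le P,Q\le\mathrm{id}$ on finite-dimensional Hilbert spaces with $\ker(P\otimes Q)\cap\ker((\mathrm{id}-P)\otimes(\mathrm{id}-Q))=\{0\}$, $P\star Q:=(P\otimes Q)\,(P^2\otimes Q^2+(\mathrm{id}-P^2)\otimes(\mathrm{id}-Q^2))^{-1/2}$; a scalar in $[0,1]$ is regarded as an operator on $\mathbb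 C$. *)

theory Defs
  imports "HOL-Analysis.Analysis" "HOL-Algebra.Group_Action"
begin

section \<open>Complex matrices\<close>

type_synonym 'n cmat = "complex^'n^'n"

definition cadj :: "'n::finite cmat \<Rightarrow> 'n cmat" where
  "cadj T = (\<chi> i j. cnj (T $ j $ i))"

definition hdot :: "complex^'n::finite \<Rightarrow> complex^'n \<Rightarrow> complex" where
  "hdot x y = (\<Sum>i\<in>UNIV. cnj (x $ i) * y $ i)"

definition psd :: "'n::finite cmat \<Rightarrow> bool" where
  "psd T \<longleftrightarrow> cadj T = T \<and> (\<forall>x. 0 \<le> Re (hdot x (T *v x)))"

definition normal_mat :: "'n::finite cmat \<Rightarrow> bool" where
  "normal_mat T \<longleftrightarrow> cadj T ** T = T ** cadj T"

definition unitary_mat :: "'n::finite cmat \<Rightarrow> bool" where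
  "unitary_mat U \<longleftrightarrow> cadj U ** U = mat 1 \<and> U ** cadj U = mat 1"

(* Meaningful for positive semidefinite T only, where the root exists and is unique. *)
definition psd_sqrt :: "'n::finite cmat \<Rightarrow> 'n cmat" where
  "psd_sqrt T = (THE S. psd S \<and> S ** S = T)"

definition mabs :: "'n::finite cmat \<Rightarrow> 'n cmat" where
  "mabs T = psd_sqrt (cadj T ** T)"

definition polar_unitary :: "'n::finite cmat \<Rightarrow> 'n cmat \<Rightarrow> bool" where
  "polar_unitary T U \<longleftrightarrow> unitary_mat U \<and> T = U ** mabs T"

definition mker :: "'n::finite cmat \<Rightarrow> (complex^'n) set" where
  "mker T = {x. T *v x = 0}"

definition kron :: "'m::finite cmat \<Rightarrow> 'n::finite cmat \<Rightarrow> ('m \<times> 'n) cmat" (infixl "\<otimes>\<^sub>m" 75) where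
  "S \<otimes>\<^sub>m T = (\<chi> p q. S $ fst p $ fst q * T $ snd p $ snd q)"

(* The identification of the tensor product of \<complex> and \<complex>^'n with \<complex>^'n; the type 1 has a single element. *)
definition unit_ident :: "(1 \<times> 'n::finite) cmat \<Rightarrow> 'n cmat" where
  "unit_ident T = (\<chi> i j. T $ (1, i) $ (1, j))"


section \<open>P-modules and their tensor product\<close>

(* The module (A, B, \<complex>^d) is the pair (A, B) with d = CARD('n). *)
type_synonym 'n pmod = "'n cmat \<times> 'n cmat"

definition P_modules :: "'n::finite pmod set" where
  "P_modules = {(A, B). cadj A ** A + cadj B ** B = mat 1}"

definition M_modules :: "'n::finite pmod set" where
  "M_modules = {(A, B) \<in> P_modules. normal_mat A \<and> invertible B}"

definition N_modules :: "'n::finite pmod set" where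
  "N_modules = {(A, B) \<in> P_modules. normal_mat A \<and> invertible A \<and> invertible B}"

definition tensor_defined :: "'m::finite pmod \<Rightarrow> 'n::finite pmod \<Rightarrow> bool" where
  "tensor_defined X Y \<longleftrightarrow>
     mker (fst X \<otimes>\<^sub>m fst Y) \<inter> mker (snd X \<otimes>\<^sub>m snd Y) = {0}"

definition tensor_K :: "'m::finite pmod \<Rightarrow> 'n::finite pmod \<Rightarrow> ('m \<times> 'n) cmat" where
  "tensor_K X Y = psd_sqrt
     ((mabs (fst X) ** mabs (fst X)) \<otimes>\<^sub>m (mabs (fst Y) ** mabs (fst Y)) +
      (mabs (snd X) ** mabs (snd X)) \<otimes>\<^sub>m (mabs (snd Y) ** mabs (snd Y)))"

(* Meaningful only if tensor_defined X Y. *)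
definition pmod_tensor :: "'m::finite pmod \<Rightarrow> 'n::finite pmod \<Rightarrow> ('m \<times> 'n) pmod" (infixl "\<boxtimes>" 75) where
  "X \<boxtimes> Y =
     ((fst X \<otimes>\<^sub>m fst Y) ** matrix_inv (tensor_K X Y),
      (snd X \<otimes>\<^sub>m snd Y) ** matrix_inv (tensor_K X Y))"

definition unit_tensor :: "1 pmod \<Rightarrow> 'n::finite pmod \<Rightarrow> 'n pmod" where
  "unit_tensor X Y = map_prod unit_ident unit_ident (X \<boxtimes> Y)"

(* The pair (mat a, mat b) of 1x1 matrices is the P-module (a, b, \<complex>); the space 1 pmod
   is isometric to \<complex>^2. *)
definition Irr_diff1 :: "1 pmod monoid" where
  "Irr_diff1 =
     \<lparr>carrier = {(mat a, mat b) | a b. (cmod a)\<^sup>2 + (cmod b)\<^sup>2 = 1 \<and> a \<noteq> 0 \<and> b \<noteq> 0},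
      monoid.mult = unit_tensor,
      one = (mat (1 / of_real (sqrt 2)), mat (1 / of_real (sqrt 2)))\<rparr>"

(* Extensional outside P_modules, as bijections of a set are in HOL-Algebra. *)
definition P_action :: "1 pmod \<Rightarrow> 'n::finite pmod \<Rightarrow> 'n pmod" where
  "P_action X = restrict (unit_tensor X) P_modules"

definition star_defined :: "'m::finite cmat \<Rightarrow> 'n::finite cmat \<Rightarrow> bool" where
  "star_defined P Q \<longleftrightarrow>
     psd P \<and> psd (mat 1 - P) \<and> psd Q \<and> psd (mat 1 - Q) \<and>
     mker (P \<otimes>\<^sub>m Q) \<inter> mker ((mat 1 - P) \<otimes>\<^sub>m (mat 1 - Q)) = {0}"

(* Meaningful only if star_defined P Q. *)
definition star :: "'m::finite cmat \<Rightarrow> 'n::finite cmat \<Rightarrow> ('m \<times> 'n) cmat" (infixl "\<star>" 75) where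
  "P \<star> Q = (P \<otimes>\<^sub>m Q) **
     matrix_inv (psd_sqrt ((P ** P) \<otimes>\<^sub>m (Q ** Q) + (mat 1 - P ** P) \<otimes>\<^sub>m (mat 1 - Q ** Q)))"

definition scalar_star :: "real \<Rightarrow> 'n::finite cmat \<Rightarrow> 'n cmat" where
  "scalar_star r Q = unit_ident ((mat (of_real r) :: 1 cmat) \<star> Q)"


section \<open>Smooth actions on submanifolds of Euclidean space\<close>

(* On an open set S of a finite-dimensional space, Ck_on k S f says that f is of class C^k. *)
primrec Ck_on :: "nat \<Rightarrow> 'a::euclidean_space set \<Rightarrow> ('a \<Rightarrow> 'b::euclidean_space) \<Rightarrow> bool" where
  "Ck_on 0 S f \<longleftrightarrow> continuous_on S f"
| "Ck_on (Suc k) S f \<longleftrightarrow>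
     (\<forall>x\<in>S. f differentiable (at x)) \<and>
     (\<forall>v. Ck_on k S (\<lambda>x. frechet_derivative f (at x) v))"

definition smooth_open :: "'a::euclidean_space set \<Rightarrow> ('a \<Rightarrow> 'b::euclidean_space) \<Rightarrow> bool" where
  "smooth_open S f \<longleftrightarrow> open S \<and> (\<forall>k. Ck_on k S f)"

(* Smoothness of a map on an arbitrary subset: local smooth extendability. For embedded
   submanifolds of Euclidean spaces this is smoothness in the sense of manifolds. *)
definition smooth_map :: "'a::euclidean_space set \<Rightarrow> ('a \<Rightarrow> 'b::euclidean_space) \<Rightarrow> bool" where
  "smooth_map S f \<longleftrightarrow>
     (\<forall>p\<in>S. \<exists>U g. p \<in> U \<and> smooth_open U g \<and> (\<forall>x\<in>S \<inter> U. g x = f x))"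

(* Embedded submanifold of dimension k, given by local defining functions: near each point,
   the zero set of a smooth submersion onto a space W of dimension DIM('a) - k. As
   DIM('a) - k is at most DIM('a), W can be taken inside 'a. *)
definition embedded_submanifold :: "nat \<Rightarrow> 'a::euclidean_space set \<Rightarrow> bool" where
  "embedded_submanifold k S \<longleftrightarrow>
     (\<forall>p\<in>S. \<exists>U W. \<exists>F :: 'a \<Rightarrow> 'a.
        p \<in> U \<and> subspace W \<and> dim W + k = DIM('a) \<and>
        smooth_open U F \<and> F ` U \<subseteq> W \<and> S \<inter> U = {x \<in> U. F x = 0} \<and>
        (\<forall>x\<in>S \<inter> U. range (frechet_derivative F (at x)) = W))"

definition lie_group :: "'a::euclidean_space monoid \<Rightarrow> bool" where
  "lie_group G \<longleftrightarrow>
     group G \<and> (\<exists>k. embedded_submanifold k (carrier G)) \<and>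
     smooth_map (carrier G \<times> carrier G) (\<lambda>(g, h). g \<otimes>\<^bsub>G\<^esub> h) \<and>
     smooth_map (carrier G) (\<lambda>g. inv\<^bsub>G\<^esub> g)"

definition lie_group_action ::
  "'a::euclidean_space monoid \<Rightarrow> 'b::euclidean_space set \<Rightarrow> ('a \<Rightarrow> 'b \<Rightarrow> 'b) \<Rightarrow> bool" where
  "lie_group_action G S \<phi> \<longleftrightarrow>
     lie_group G \<and> (\<exists>k. embedded_submanifold k S) \<and>
     group_action G S \<phi> \<and> smooth_map (carrier G \<times> S) (\<lambda>(g, x). \<phi> g x)"

end

theory Submission
  imports Defs
begin

text \<open>The theorem rests on one observation: since \<open>A\<^sup>*A + B\<^sup>*B = 1\<close>, the operator
  \<open>K = (|a|\<^sup>2 A\<^sup>*A + |b|\<^sup>2 B\<^sup>*B)\<^sup>1\<^sup>/\<^sup>2\<close> is a function of \<open>A\<^sup>*A\<close> alone. It is invertible when \<open>a\<close> and \<open>b\<close> are nonzero,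
  and it commutes with everything that commutes with \<open>A\<^sup>*A\<close> (\<open>commute_gram_root\<close>).

  \<^emph>\<open>Algebra.\<close> All operators \<open>K\<close> that arise from one module commute, so normalising twice is the
  same as normalising once by the product of the scalars; this is the action law
  \<open>unit_tensor_compat\<close>. It is stated for arbitrary nonzero \<open>a, b\<close>, and \<open>unit_tensor_scale\<close> says that only
  the ray of \<open>(a, b)\<close> matters. The group law on \<open>Irr_diff1\<close> is the case of dimension one, so that its
  associativity is the action law again. If \<open>A\<close> is normal then \<open>A\<close> commutes with \<open>A\<^sup>*A\<close>, hence with
  \<open>K\<close>, and \<open>aAK\<^sup>-\<^sup>1\<close> is normal; invertibility is preserved because \<open>a\<close>, \<open>b\<close> and \<open>K\<close> are invertible. The
  formula with polar parts is obtained by writing \<open>1 - |A|\<^sup>2 = |B|\<^sup>2\<close> in \<open>|a| \<star> |A|\<close>.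

  \<^emph>\<open>Analysis.\<close> The P-modules are the zero set of \<open>A\<^sup>*A + B\<^sup>*B - 1\<close>, which is a submersion onto the Hermitian
  matrices along this set (\<open>embedded_submanifold_P_modules\<close>). For the smoothness of the action it suffices
  that \<open>T \<mapsto> T\<^sup>1\<^sup>/\<^sup>2\<close> is smooth at positive definite \<open>T\<close>. With \<open>R = T\<^sup>1\<^sup>/\<^sup>2\<close>, the equation \<open>RR = T\<close> gives
  \<open>R dR + dR R = dT\<close>, a Lyapunov equation; its left side is coercive in \<open>dR\<close>, hence it is uniquely
  solvable (\<open>lyap_solution\<close>), which yields the first derivative. The solution of a
  Lyapunov equation has a derivative that solves another one with the same \<open>R\<close>. So the expressions built
  from polynomials, \<open>R\<close> and solutions of such equations form a family closed under differentiation
  (\<open>root_map_has_derivative\<close>), and every member of such a family is smooth. The inverse is in the family too, as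
  \<open>X = R\<^sup>-\<^sup>1\<close> solves \<open>RX + XR = 2\<close>.\<close>

section \<open>Matrix algebra over the complex numbers\<close>

lemma mat_mult_nth: "((mat c :: 'n::finite cmat) ** T) $ i $ j = c * T $ i $ j"
proof -
  have "((mat c :: 'n::finite cmat) ** T) $ i $ j = (\<Sum>k\<in>UNIV. if i = k then c * T $ k $ j else 0)"
    unfolding matrix_matrix_mult_def mat_def vec_lambda_beta by (rule sum.cong) auto
  then show ?thesis by simp
qed

lemma mult_mat_nth: "(T ** (mat c :: 'n::finite cmat)) $ i $ j = c * T $ i $ j"
proof -
  have "(T ** (mat c :: 'n::finite cmat)) $ i $ j = (\<Sum>k\<in>UNIV. if j = k then c * T $ i $ k else 0)"
    unfolding matrix_matrix_mult_def mat_def vec_lambda_beta by (rule sum.cong) auto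
  then show ?thesis by simp
qed

lemma mat_diag [simp]: "(mat c :: 'n::finite cmat) $ i $ i = c"
  by (simp add: mat_def)

lemma mat_eq_mat_iff [simp]: "(mat c :: 'n::finite cmat) = mat d \<longleftrightarrow> c = d"
  by (metis mat_diag)

lemma mult_mat_commute: "T ** mat c = mat c ** (T :: 'n::finite cmat)"
  by (simp add: vec_eq_iff mat_mult_nth mult_mat_nth)

lemma mult_mat_left_commute: "(S :: 'n::finite cmat) ** (mat c ** T) = mat c ** (S ** (T :: 'n::finite cmat))"
  by (simp only: matrix_mul_assoc mult_mat_commute[of S])

lemma mat_mult_mat: "(mat c :: 'n::finite cmat) ** mat d = mat (c * d)"
  by (simp add: vec_eq_iff mat_mult_nth) (simp add: mat_def)

lemma mat_mult_mat_assoc: "(mat c :: 'n::finite cmat) ** (mat d ** T) = mat (c * d) ** T"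
  by (simp add: matrix_mul_assoc mat_mult_mat)

lemma mat_add: "(mat c :: 'n::finite cmat) + mat d = mat (c + d)"
  by (simp add: vec_eq_iff mat_def)

lemma mat_diff: "(mat c :: 'n::finite cmat) - mat d = mat (c - d)"
  by (simp add: vec_eq_iff mat_def)

lemma scaleR_conv_mat: "r *\<^sub>R (T :: 'n::finite cmat) = mat (of_real r) ** T"
  by (simp add: vec_eq_iff mat_mult_nth) (simp add: scaleR_conv_of_real)

lemma mat_vector_mult: "(mat c :: 'n::finite cmat) *v x = c *s x"
proof -
  have "((mat c :: 'n::finite cmat) *v x) $ i = (\<Sum>k\<in>UNIV. if i = k then c * x $ k else 0)"
    for i unfolding matrix_vector_mult_def mat_def vec_lambda_beta by (rule sum.cong) auto
  then show ?thesis by (simp add: vec_eq_iff)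
qed

lemma scaleR_matrix_vector: "(r *\<^sub>R (T :: 'n::finite cmat)) *v x = r *\<^sub>R (T *v x)"
  by (simp add: vec_eq_iff matrix_vector_mult_def scaleR_sum_right)

lemma matrix_add_rdistrib: "(A + B) ** C = A ** C + B ** (C :: 'n::finite cmat)"
  by (simp add: vec_eq_iff matrix_matrix_mult_def distrib_right sum.distrib)

lemma matrix_diff_rdistrib: "(A - B) ** C = A ** C - B ** (C :: 'n::finite cmat)"
  by (simp add: vec_eq_iff matrix_matrix_mult_def left_diff_distrib sum_subtractf)

lemma matrix_diff_ldistrib: "C ** (A - B) = C ** A - C ** (B :: 'n::finite cmat)"
  by (simp add: vec_eq_iff matrix_matrix_mult_def right_diff_distrib sum_subtractf)

lemma matrix_mult_scaleR: "(S :: 'n::finite cmat) ** (r *\<^sub>R T) = r *\<^sub>R (S ** (T :: 'n::finite cmat))"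
  unfolding scaleR_conv_mat by (rule mult_mat_left_commute)

lemma scaleR_matrix_mult: "(r *\<^sub>R (S :: 'n::finite cmat)) ** T = r *\<^sub>R (S ** (T :: 'n::finite cmat))"
  by (simp add: scalar_matrix_assoc)

lemma bounded_bilinear_matrix_mult:
  "bounded_bilinear ((**) :: 'n::finite cmat \<Rightarrow> 'n cmat \<Rightarrow> 'n cmat)"
  by (intro bilinear_conv_bounded_bilinear[THEN iffD1])
    (auto simp: bilinear_def matrix_add_ldistrib matrix_add_rdistrib matrix_mult_scaleR
      scaleR_matrix_mult intro!: linearI)

lemma matrix_inv_eqI:
  assumes "S ** T = mat (1::complex)" shows "matrix_inv S = (T :: 'n::finite cmat)"
proof -
  have 1: "T ** S = mat 1" using assms by (simp add: matrix_left_right_inverse)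
  then have "\<exists>X. S ** X = mat 1 \<and> X ** S = mat 1" using assms by blast
  from someI_ex[OF this] have "S ** matrix_inv S = mat 1" by (simp add: matrix_inv_def)
  then have "T ** S ** matrix_inv S = T" by (simp add: matrix_mul_assoc[symmetric])
  with 1 show ?thesis by simp
qed

lemma invertible_matrix_inv:
  assumes "invertible (S :: 'n::finite cmat)"
  shows "S ** matrix_inv S = mat 1" "matrix_inv S ** S = mat 1"
proof -
  have "S ** matrix_inv S = mat 1 \<and> matrix_inv S ** S = mat 1"
    using assms unfolding invertible_def matrix_inv_def by (rule someI_ex)
  then show "S ** matrix_inv S = mat 1" "matrix_inv S ** S = mat 1" by auto
qed

lemma matrix_inv_mat: "c \<noteq> 0 \<Longrightarrow> matrix_inv (mat c :: 'n::finite cmat) = mat (1 / c)"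
  by (rule matrix_inv_eqI) (simp add: mat_mult_mat)

lemma matrix_inv_invertible: "invertible (S :: 'n::finite cmat) \<Longrightarrow> invertible (matrix_inv S)"
  using invertible_matrix_inv unfolding invertible_def by blast

lemma invertible_mat: "c \<noteq> 0 \<Longrightarrow> invertible (mat c :: 'n::finite cmat)"
  unfolding invertible_right_inverse by (rule exI[of _ "mat (1 / c)"]) (simp add: mat_mult_mat)

lemma commute_matrix_inv:
  assumes "invertible (S :: 'n::finite cmat)" "C ** S = S ** C"
  shows "C ** matrix_inv S = matrix_inv S ** C"
proof -
  have "matrix_inv S ** (S ** C) ** matrix_inv S = C ** matrix_inv S"
    by (simp add: matrix_mul_assoc invertible_matrix_inv[OF assms(1)])
  moreover have "matrix_inv S ** (C ** S) ** matrix_inv S = matrix_inv S ** C"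
    unfolding matrix_mul_assoc[symmetric] invertible_matrix_inv[OF assms(1)] by simp
  ultimately show ?thesis using assms(2) by simp
qed

lemma cadj_nth [simp]: "cadj T $ i $ j = cnj (T $ j $ i)"
  by (simp add: cadj_def)

lemma cadj_simps [simp]:
  "cadj (S ** T) = cadj T ** cadj S" "cadj (S + T) = cadj S + cadj T" "cadj (S - T) = cadj S - cadj T"
  "cadj (cadj T) = T" "cadj (mat c :: 'n::finite cmat) = mat (cnj c)" "cadj (r *\<^sub>R T) = r *\<^sub>R cadj T"
  "cadj (0 :: 'n::finite cmat) = 0"
  by (auto simp: vec_eq_iff matrix_matrix_mult_def mat_def mult.commute)

lemma cadj_matrix_inv:
  assumes "invertible (S :: 'n::finite cmat)" shows "cadj (matrix_inv S) = matrix_inv (cadj S)"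
proof (rule matrix_inv_eqI[symmetric])
  show "cadj S ** cadj (matrix_inv S) = mat 1"
    unfolding cadj_simps(1)[symmetric] by (simp add: assms invertible_matrix_inv del: cadj_simps(1))
qed

lemma bounded_linear_cadj: "bounded_linear (cadj :: 'n::finite cmat \<Rightarrow> 'n cmat)"
  unfolding linear_conv_bounded_linear[symmetric] by (rule linearI) auto

subsection \<open>The real inner product and adjoints\<close>

lemma inner_complex_Re: "x \<bullet> y = Re (cnj x * y)" for x y :: complex
  by (simp add: inner_complex_def)

lemma Re_hdot: "Re (hdot x y) = x \<bullet> y"
  by (simp add: hdot_def inner_vec_def inner_complex_Re)

lemma inner_matrix_vector: "x \<bullet> (T *v y) = (cadj T *v x) \<bullet> y"
proof -
  have "hdot x (T *v y) = hdot (cadj T *v x) y"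
  proof -
    have "hdot x (T *v y) = (\<Sum>i\<in>UNIV. \<Sum>j\<in>UNIV. cnj (x $ i) * T $ i $ j * y $ j)"
      by (simp add: hdot_def matrix_vector_mult_def sum_distrib_left mult.assoc)
    also have "\<dots> = (\<Sum>j\<in>UNIV. \<Sum>i\<in>UNIV. cnj (x $ i) * T $ i $ j * y $ j)"
      by (rule sum.swap)
    also have "\<dots> = hdot (cadj T *v x) y"
      by (simp add: hdot_def matrix_vector_mult_def sum_distrib_right mult.commute[of _ "cnj _"])
    finally show ?thesis .
  qed
  then show ?thesis by (simp flip: Re_hdot)
qed

lemma inner_cadj_mult_self: "x \<bullet> ((cadj M ** M) *v x) = (norm (M *v x))\<^sup>2"
  unfolding matrix_vector_mul_assoc[symmetric] inner_matrix_vector[of x "cadj M"]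
  by (simp only: cadj_simps power2_norm_eq_inner)

lemma inner_matrix_columns: "(X :: 'n::finite cmat) \<bullet> Y = (\<Sum>j\<in>UNIV. column j X \<bullet> column j Y)"
proof -
  have "X \<bullet> Y = (\<Sum>i\<in>UNIV. \<Sum>j\<in>UNIV. X $ i $ j \<bullet> Y $ i $ j)" by (simp add: inner_vec_def)
  also have "\<dots> = (\<Sum>j\<in>UNIV. \<Sum>i\<in>UNIV. X $ i $ j \<bullet> Y $ i $ j)" by (rule sum.swap)
  finally show ?thesis by (simp add: inner_vec_def column_def)
qed

lemma column_matrix_mult: "column j (S ** T) = S *v column j (T :: 'n::finite cmat)"
  by (simp add: column_def vec_eq_iff matrix_matrix_mult_def matrix_vector_mult_def)

lemma matrix_eq_0_columns: "(\<And>j. column j X = 0) \<Longrightarrow> X = (0 :: 'n::finite cmat)"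
  by (simp add: vec_eq_iff column_def)

lemma inner_cadj_cadj: "cadj (X :: 'n::finite cmat) \<bullet> cadj Y = X \<bullet> (Y :: 'n::finite cmat)"
proof -
  have "cadj X \<bullet> cadj Y = (\<Sum>i\<in>UNIV. \<Sum>j\<in>UNIV. X $ j $ i \<bullet> Y $ j $ i)"
    by (simp add: inner_vec_def inner_complex_def)
  also have "\<dots> = (\<Sum>j\<in>UNIV. \<Sum>i\<in>UNIV. X $ j $ i \<bullet> Y $ j $ i)" by (rule sum.swap)
  finally show ?thesis by (simp add: inner_vec_def)
qed

lemma cadj_mult_self_eq_0: 
  assumes "cadj (X :: 'n::finite cmat) ** X = 0" shows "X = (0 :: 'n::finite cmat)"
proof (rule matrix_eq_0_columns)
  fix j
  have "cadj X *v column j X = 0"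
    using column_matrix_mult[of j "cadj X" X] by (simp add: assms) (simp add: column_def vec_eq_iff)
  moreover have "column j X = X *v axis j 1"
    by (simp add: column_def matrix_vector_mult_def axis_def vec_eq_iff if_distrib cong: if_cong)
  ultimately have "column j X \<bullet> column j X = 0"
    by (metis inner_matrix_vector inner_zero_left)
  then show "column j X = 0" by simp
qed

section \<open>Positive semidefinite matrices\<close>

lemma psd_iff: "psd T \<longleftrightarrow> cadj T = T \<and> (\<forall>x. 0 \<le> x \<bullet> (T *v x))"
  by (simp add: psd_def Re_hdot)

lemma psdD: "psd T \<Longrightarrow> cadj T = T" "psd T \<Longrightarrow> 0 \<le> x \<bullet> (T *v x)"
  by (auto simp: psd_iff)

lemma psd_add: "psd S \<Longrightarrow> psd T \<Longrightarrow> psd (S + T)"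
  by (simp add: psd_iff matrix_vector_mult_add_rdistrib inner_add_right)

text \<open>Congruence by \<open>X\<close> evaluates the quadratic form of \<open>T\<close> at \<open>Xx\<close>.\<close>

lemma psd_congruence: "psd T \<Longrightarrow> psd (cadj X ** T ** X)"
proof -
  assume "psd T"
  moreover have "x \<bullet> ((cadj X ** T ** X) *v x) = (X *v x) \<bullet> (T *v (X *v x))" for x
    by (simp add: inner_matrix_vector[of _ "cadj X"] flip: matrix_vector_mul_assoc)
  ultimately show ?thesis by (simp add: psd_iff matrix_mul_assoc)
qed

lemma psd_mat: "0 \<le> r \<Longrightarrow> psd (mat (of_real r) :: 'n::finite cmat)"
proof -
  assume r: "0 \<le> r"
  have "(of_real r :: complex) *s x = r *\<^sub>R x" for x :: "complex^'n"
    by (simp add: vec_eq_iff) (simp add: scaleR_conv_of_real)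
  then show ?thesis using r by (simp add: psd_iff mat_vector_mult)
qed

lemma psd_cadj_mult: "psd (cadj X ** X)"
  using psd_congruence[OF psd_mat[of 1], of X] by simp

lemma psd_matrix_inv:
  assumes "psd S" "invertible S" shows "psd (matrix_inv S)"
proof -
  have "psd (cadj (matrix_inv S) ** S ** matrix_inv S)" using assms by (intro psd_congruence)
  then show ?thesis
    using assms by (simp add: cadj_matrix_inv psdD invertible_matrix_inv)
qed

text \<open>A nonnegative quadratic form that vanishes at \<open>x\<close> is minimal there, so its gradient \<open>2Tx\<close> is zero:
  moving from \<open>x\<close> a little in the direction \<open>-Tx\<close> would make the form negative.\<close>

lemma psd_form_eq_0:
  assumes T: "psd T" and x: "x \<bullet> (T *v x) = 0" shows "T *v x = 0"
proof (rule ccontr)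
  define w where "w = T *v x"
  assume "T *v x \<noteq> 0"
  then have c: "w \<bullet> w > 0" by (simp add: w_def)
  have e: "w \<bullet> (T *v w) \<ge> 0" using T by (simp add: psdD)
  have xw: "x \<bullet> (T *v w) = w \<bullet> w"
    using T by (simp add: inner_matrix_vector psdD w_def)
  \<comment> \<open>The step is short enough for the linear decrease \<open>2t (w \<bullet> w)\<close> to exceed the quadratic term.\<close>
  define t where "t = (w \<bullet> w) / (1 + w \<bullet> (T *v w))"
  have t: "t > 0" using c e by (simp add: t_def)
  have "0 \<le> (x - t *\<^sub>R w) \<bullet> (T *v (x - t *\<^sub>R w))" using T by (simp add: psdD)
  also have "\<dots> = t * (t * (w \<bullet> (T *v w)) - 2 * (w \<bullet> w))"
    using x xw by (simp add: matrix_vector_mult_diff_distrib linear_scale[OF matrix_vector_mul_linear] inner_diff_left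
        inner_diff_right w_def[symmetric] algebra_simps inner_commute)
  finally have "t * (w \<bullet> (T *v w)) \<ge> 2 * (w \<bullet> w)" using t by (simp add: zero_le_mult_iff)
  moreover have "t * (w \<bullet> (T *v w)) \<le> w \<bullet> w"
  proof -
    have "t * (w \<bullet> (T *v w)) = (w \<bullet> w) * ((w \<bullet> (T *v w)) / (1 + w \<bullet> (T *v w)))" by (simp add: t_def)
    also have "\<dots> \<le> (w \<bullet> w) * 1" using c e by (intro mult_left_mono) auto
    finally show ?thesis by simp
  qed
  ultimately show False using c by simp
qed

subsection \<open>Square roots\<close>

text \<open>A maximiser \<open>v\<close> of the Rayleigh quotient, with maximum \<open>l\<close>, is a zero of the nonnegative form of
  \<open>l - T\<close>, and hence lies in its kernel.\<close>

lemma psd_max_eigenvector: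
  assumes T: "psd (T :: 'n::finite cmat)" and nz: "T \<noteq> 0"
  obtains l v where "l > 0" "norm v = 1" "T *v v = l *\<^sub>R v"
proof -
  have cont: "continuous_on (sphere 0 1) (\<lambda>x. x \<bullet> (T *v x))"
    by (intro continuous_intros linear_continuous_on linear_conv_bounded_linear[THEN iffD1] matrix_vector_mul_linear)
  have ne: "sphere (0 :: complex^'n) 1 \<noteq> {}" by simp
  from continuous_attains_sup[OF compact_sphere ne cont]
  obtain v where v: "norm v = 1" and max: "\<And>x. norm x = 1 \<Longrightarrow> x \<bullet> (T *v x) \<le> v \<bullet> (T *v v)"
    by auto
  define l where "l = v \<bullet> (T *v v)"
  have max': "x \<bullet> (T *v x) \<le> l * (x \<bullet> x)" for x
  proof (cases "x = 0")
    case False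
    have "(x /\<^sub>R norm x) \<bullet> (T *v (x /\<^sub>R norm x)) \<le> l"
      unfolding l_def using False by (intro max) simp
    then have "(x \<bullet> (T *v x)) / (norm x * norm x) \<le> l"
      by (simp add: linear_scale[OF matrix_vector_mul_linear] field_simps)
    then show ?thesis using False by (simp add: field_simps flip: power2_norm_eq_inner power2_eq_square)
  qed simp
  define M where "M = mat (of_real l) - T"
  have lv: "mat (of_real l) *v x = l *\<^sub>R x" for x :: "complex^'n"
    by (simp add: mat_vector_mult vec_eq_iff) (simp add: scaleR_conv_of_real)
  have M: "psd M" "v \<bullet> (M *v v) = 0"
    using max' v psdD(1)[OF T]
    by (simp_all add: M_def psd_iff matrix_vector_mult_diff_rdistrib lv inner_diff_right l_def[symmetric] norm_eq_1)
  then have "M *v v = 0" by (rule psd_form_eq_0)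
  then have eig: "T *v v = l *\<^sub>R v" by (simp add: M_def matrix_vector_mult_diff_rdistrib lv)
  have "l > 0"
  proof (rule ccontr)
    assume "\<not> l > 0"
    then have "l * (x \<bullet> x) \<le> 0" for x by (simp add: mult_nonpos_nonneg)
    then have "x \<bullet> (T *v x) = 0" for x
      using max'[of x] psdD(2)[OF T, of x] by (meson order.antisym order.trans)
    then have "T *v x = 0" for x by (rule psd_form_eq_0[OF T])
    then show False using nz by (simp add: matrix_eq[of T 0])
  qed
  with v eig that show thesis by blast
qed

definition outer :: "complex^'n::finite \<Rightarrow> 'n cmat" where
  "outer v = (\<chi> i j. v $ i * cnj (v $ j))"

lemma outer_mult: "T ** outer v = (\<chi> i j. (T *v v) $ i * cnj (v $ j))"
  by (simp add: outer_def vec_eq_iff matrix_matrix_mult_def matrix_vector_mult_def sum_distrib_right mult.assoc)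

lemma cadj_outer [simp]: "cadj (outer v) = outer v"
  by (simp add: outer_def vec_eq_iff)

lemma outer_vector: "outer v *v x = hdot v x *s v"
  by (simp add: outer_def vec_eq_iff matrix_vector_mult_def hdot_def sum_distrib_left sum_distrib_right mult_ac)

lemma hdot_norm_1: "norm v = 1 \<Longrightarrow> hdot v v = 1"
proof -
  have "hdot v v = of_real (v \<bullet> v)"
    by (simp add: hdot_def inner_vec_def complex_eq_iff inner_complex_def)
  then show "norm v = 1 \<Longrightarrow> hdot v v = 1" by (simp add: norm_eq_1)
qed

text \<open>Split off the top eigenvector: \<open>T - l vv\<^sup>*\<close> is positive semidefinite with a strictly larger
  kernel, and a square root of it annihilates \<open>v\<close>, so that adding \<open>\<surd>l vv\<^sup>*\<close> gives a square
  root of \<open>T\<close>.\<close>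

lemma psd_sqrt_exists:
  assumes "psd (T :: 'n::finite cmat)" shows "\<exists>S. psd S \<and> S ** S = T"
  using assms
proof (induction "DIM(complex^'n) - dim (mker T)" arbitrary: T rule: less_induct)
  case less
  show ?case
  proof (cases "T = 0")
    case True
    have "psd (0 :: 'n cmat)" using psd_mat[of 0] by simp
    then show ?thesis using True by (intro exI[of _ 0]) simp
  next
    case False
    obtain l v where l: "l > 0" and v: "norm v = 1" and eig: "T *v v = l *\<^sub>R v"
      using psd_max_eigenvector[OF less.prems False] by blast
    have oo: "outer v ** outer v = outer v"
      by (simp add: outer_mult outer_vector hdot_norm_1 v) (simp add: outer_def)
    have To: "T ** outer v = l *\<^sub>R outer v"
      unfolding outer_mult eig by (simp add: outer_def vec_eq_iff)
    have oT: "outer v ** T = l *\<^sub>R outer v"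
      using arg_cong[OF To, of cadj] by (simp add: psdD(1)[OF less.prems])
    define T1 where "T1 = T - l *\<^sub>R outer v"
    have "T1 = cadj (mat 1 - outer v) ** T ** (mat 1 - outer v)"
      by (simp add: T1_def matrix_diff_ldistrib matrix_diff_rdistrib To oT oo scaleR_matrix_mult)
    then have T1: "psd T1" by (simp add: psd_congruence less.prems del: cadj_simps)
    have T1v: "T1 *v v = 0"
      by (simp add: T1_def matrix_vector_mult_diff_rdistrib eig scaleR_matrix_vector outer_vector
         hdot_norm_1 v)
    have sub: "subspace (mker X)" for X :: "'n cmat"
      unfolding mker_def by (rule linear_subspace_kernel) (rule matrix_vector_mul_linear)
    have "mker T \<subset> mker T1"
    proof
      show "mker T \<subseteq> mker T1"
      proof
        fix x assume "x \<in> mker T"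
        then have Tx: "T *v x = 0" by (simp add: mker_def)
        have "l *\<^sub>R (outer v *v x) = (outer v ** T) *v x" by (simp add: oT scaleR_matrix_vector)
        also have "\<dots> = 0" using Tx by (simp flip: matrix_vector_mul_assoc)
        finally show "x \<in> mker T1" using Tx
          by (simp add: mker_def T1_def matrix_vector_mult_diff_rdistrib scaleR_matrix_vector)
      qed
      have "v \<noteq> 0" using v by auto
      then have "v \<notin> mker T" using l eig by (simp add: mker_def)
      then show "mker T \<noteq> mker T1" using T1v by (auto simp: mker_def)
    qed
    moreover have "span (mker T) = mker T" "span (mker T1) = mker T1" using sub by (simp_all add: span_eq_iff)
    ultimately have "dim (mker T) < dim (mker T1)" by (intro dim_psubset) (simp only:)
    moreover have "dim (mker T1) \<le> DIM(complex^'n)" by (rule dim_subset_UNIV)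
    ultimately have "DIM(complex^'n) - dim (mker T1) < DIM(complex^'n) - dim (mker T)" by linarith
    from less.hyps[OF this T1] obtain S1 where S1: "psd S1" "S1 ** S1 = T1" by blast
    have "(S1 *v v) \<bullet> (S1 *v v) = v \<bullet> (T1 *v v)"
      by (simp add: inner_matrix_vector psdD(1)[OF S1(1)] flip: S1(2) matrix_vector_mul_assoc)
    then have S1v: "S1 *v v = 0" by (simp add: T1v)
    have So: "S1 ** outer v = 0" by (simp add: outer_mult S1v vec_eq_iff)
    have oS: "outer v ** S1 = 0"
      using arg_cong[OF So, of cadj] by (simp add: psdD(1)[OF S1(1)])
    define S where "S = S1 + sqrt l *\<^sub>R outer v"
    have "psd (sqrt l *\<^sub>R outer v)"
      using psd_congruence[OF psd_mat[of "sqrt l"], of "outer v"] l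
      by (simp add: oo scaleR_conv_mat mult_mat_commute flip: matrix_mul_assoc)
    then have "psd S" unfolding S_def by (rule psd_add[OF S1(1)])
    moreover have "S ** S = T"
      using l by (simp add: S_def matrix_add_ldistrib matrix_add_rdistrib matrix_mult_scaleR
          scaleR_matrix_mult So oS oo S1(2) T1_def)
    ultimately show ?thesis by blast
  qed
qed

lemma inner_left_mult_nonneg: "psd S \<Longrightarrow> 0 \<le> X \<bullet> (S ** (X :: 'n::finite cmat))"
  by (simp add: inner_matrix_columns column_matrix_mult sum_nonneg psdD)

lemma inner_right_mult_nonneg: "psd S \<Longrightarrow> 0 \<le> X \<bullet> ((X :: 'n::finite cmat) ** S)"
  using inner_left_mult_nonneg[of S "cadj X"] inner_cadj_cadj[of X "X ** S"] by (simp add: psdD)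

lemma inner_left_mult_eq_0:
  assumes "psd S" "X \<bullet> (S ** (X :: 'n::finite cmat)) = 0" shows "S ** X = 0"
proof (rule matrix_eq_0_columns)
  fix j
  have "\<forall>j\<in>UNIV. column j X \<bullet> (S *v column j X) = 0"
    using assms(2) unfolding inner_matrix_columns column_matrix_mult
    by (subst (asm) sum_nonneg_eq_0_iff) (auto simp: psdD[OF assms(1)])
  then show "column j (S ** X) = 0"
    by (simp add: column_matrix_mult psd_form_eq_0[OF assms(1)])
qed

lemma inner_right_mult_eq_0:
  assumes "psd S" "X \<bullet> ((X :: 'n::finite cmat) ** S) = 0" shows "X ** S = 0"
proof -
  have "S ** cadj X = 0"
    using assms inner_cadj_cadj[of X "X ** S"] by (intro inner_left_mult_eq_0) (simp_all add: psdD)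
  from arg_cong[OF this, of cadj] show ?thesis by (simp add: psdD[OF assms(1)])
qed

text \<open>Pairing the equation with \<open>X\<close> gives a sum of two nonnegative terms, so both vanish.\<close>

lemma psd_sylvester_eq_0:
  assumes "psd S" "psd S'" "S ** X + X ** S' = (0 :: 'n::finite cmat)"
  shows "S ** X = 0" "X ** S' = 0"
proof -
  have "X \<bullet> (S ** X) + X \<bullet> (X ** S') = 0" using assms(3) by (simp flip: inner_add_right)
  then have "X \<bullet> (S ** X) = 0" "X \<bullet> (X ** S') = 0"
    using inner_left_mult_nonneg[OF assms(1), of X] inner_right_mult_nonneg[OF assms(2), of X] by auto
  then show "S ** X = 0" "X ** S' = 0"
    by (auto intro: inner_left_mult_eq_0[OF assms(1)] inner_right_mult_eq_0[OF assms(2)])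
qed

text \<open>The difference \<open>X\<close> of two roots of one matrix solves \<open>SX + XS\<^sup>\<prime> = 0\<close>.\<close>

lemma psd_sqrt_unique:
  assumes "psd S" "psd S'" "S ** S = S' ** S'" shows "S = (S' :: 'n::finite cmat)"
proof -
  define X where "X = S - S'"
  have "S ** X + X ** S' = 0"
    using assms(3) by (simp add: X_def matrix_diff_ldistrib matrix_diff_rdistrib)
  from psd_sylvester_eq_0[OF assms(1,2) this] have "S ** X = 0" "X ** S' = 0" .
  moreover have "cadj X = X" using assms by (simp add: X_def psdD)
  moreover from this have "S' ** X = cadj (X ** S')" using assms by (simp add: psdD)
  ultimately have "cadj X ** X = 0"
    by (simp add: X_def matrix_diff_rdistrib)
  then have "X = 0" by (rule cadj_mult_self_eq_0)
  then show ?thesis by (simp add: X_def)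
qed

lemma psd_sqrt_eqI: "psd S \<Longrightarrow> S ** S = T \<Longrightarrow> psd_sqrt T = S"
  unfolding psd_sqrt_def by (rule the_equality) (auto intro: psd_sqrt_unique)

lemma psd_sqrt:
  assumes "psd T" shows "psd (psd_sqrt T)" "psd_sqrt T ** psd_sqrt T = T"
proof -
  obtain S where "psd S" "S ** S = T" using psd_sqrt_exists[OF assms] by blast
  then show "psd (psd_sqrt T)" "psd_sqrt T ** psd_sqrt T = T" using psd_sqrt_eqI[of S T] by auto
qed

lemma mabs: "psd (mabs A)" "mabs A ** mabs A = cadj A ** A"
  unfolding mabs_def by (simp_all add: psd_sqrt psd_cadj_mult)

lemma invertible_psd_sqrt:
  assumes "psd T" "invertible T" shows "invertible (psd_sqrt T)"
proof -
  have "psd_sqrt T ** (psd_sqrt T ** matrix_inv T) = mat 1"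
    by (simp add: matrix_mul_assoc psd_sqrt(2)[OF assms(1)] invertible_matrix_inv[OF assms(2)])
  then show ?thesis unfolding invertible_right_inverse by blast
qed

text \<open>With \<open>S\<close> the root of \<open>T\<close>, the commutator \<open>X = SC - CS\<close> solves \<open>SX + XS = TC - CT = 0\<close>, and this equation has
  only the trivial solution.\<close>

lemma psd_sqrt_commute:
  assumes T: "psd T" and inv: "invertible T" and c: "C ** T = T ** (C :: 'n::finite cmat)"
  shows "C ** psd_sqrt T = psd_sqrt T ** C"
proof -
  define S where "S = psd_sqrt T"
  have S: "psd S" "S ** S = T" "invertible S" using T inv by (simp_all add: S_def psd_sqrt invertible_psd_sqrt)
  define X where "X = S ** C - C ** S"
  have "S ** X + X ** S = S ** S ** C - C ** (S ** S)"
    by (simp add: X_def matrix_diff_ldistrib matrix_diff_rdistrib matrix_mul_assoc)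
  then have "S ** X + X ** S = 0" by (simp add: S c)
  from psd_sylvester_eq_0(1)[OF S(1,1) this] have "matrix_inv S ** (S ** X) = 0" by simp
  then have "X = 0" by (simp add: matrix_mul_assoc invertible_matrix_inv[OF S(3)])
  then show ?thesis by (simp add: X_def S_def)
qed

text \<open>The product equals \<open>Q\<^sup>1\<^sup>/\<^sup>2 P Q\<^sup>1\<^sup>/\<^sup>2\<close>, because \<open>P\<close> commutes with the root of \<open>Q\<close> as well.\<close>

lemma psd_mult_commuting:
  assumes P: "psd P" and Q: "psd Q" "invertible Q" and c: "P ** Q = Q ** (P :: 'n::finite cmat)"
  shows "psd (P ** Q)"
proof -
  have "P ** psd_sqrt Q = psd_sqrt Q ** P" using Q c by (intro psd_sqrt_commute) auto
  then have "cadj (psd_sqrt Q) ** P ** psd_sqrt Q = psd_sqrt Q ** psd_sqrt Q ** P"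
    using psd_sqrt(1)[OF Q(1)] by (simp add: psdD flip: matrix_mul_assoc)
  then have "cadj (psd_sqrt Q) ** P ** psd_sqrt Q = P ** Q" using c psd_sqrt[OF Q(1)] by simp
  then show ?thesis using psd_congruence[OF P, of "psd_sqrt Q"] by simp
qed

section \<open>The tensor product with a module over \<open>\<complex>\<close>\<close>

lemma sum_UNIV_1_prod: "(\<Sum>p\<in>(UNIV :: (1 \<times> 'n::finite) set). f p) = (\<Sum>i\<in>UNIV. f (1, i))"
proof -
  have "p = (1, snd p)" for p :: "1 \<times> 'n" by (cases p) simp
  then have "UNIV = Pair (1 :: 1) ` (UNIV :: 'n set)" by blast
  then have "(\<Sum>p\<in>UNIV. f p) = sum f (Pair (1 :: 1) ` (UNIV :: 'n set))" by (rule arg_cong)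
  also have "\<dots> = (\<Sum>i\<in>UNIV. f (1, i))" by (subst sum.reindex) (auto simp: inj_on_def)
  finally show ?thesis .
qed

lemma unit_ident_nth [simp]: "unit_ident T $ i $ j = T $ (1, i) $ (1, j)"
  by (simp add: unit_ident_def)

lemma unit_ident_simps:
  "unit_ident (S ** T) = unit_ident S ** unit_ident T"
  "unit_ident (S + T) = unit_ident S + unit_ident T"
  "unit_ident (S - T) = unit_ident S - unit_ident T"
  "unit_ident (cadj T) = cadj (unit_ident T)"
  "unit_ident (mat c) = mat c"
  "unit_ident 0 = 0"
  by (simp_all add: vec_eq_iff matrix_matrix_mult_def sum_UNIV_1_prod) (simp add: mat_def)

lemma unit_ident_inject: "unit_ident S = unit_ident T \<longleftrightarrow> S = T"
proof
  assume eq: "unit_ident S = unit_ident T"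
  show "S = T"
  proof (simp only: vec_eq_iff, intro allI)
    fix p q :: "1 \<times> 'a"
    show "S $ p $ q = T $ p $ q"
    proof -
      obtain i j where "p = (1, i)" "q = (1, j)" by (cases p, cases q) auto
      then show ?thesis using arg_cong[OF eq, of "\<lambda>X. X $ i $ j"] by simp
    qed

  qed
qed simp

lemma unit_ident_kron: "unit_ident ((S :: 1 cmat) \<otimes>\<^sub>m T) = mat (S $ 1 $ 1) ** T"
  by (simp add: vec_eq_iff kron_def mat_mult_nth)

lemma cmat_1_eq: "mat (S $ 1 $ 1) = (S :: 1 cmat)"
  by (simp add: vec_eq_iff mat_def)

lemma psd_unit_ident: "psd (unit_ident T) \<longleftrightarrow> psd T"
proof -
  have herm: "cadj (unit_ident T) = unit_ident T \<longleftrightarrow> cadj T = T"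
    by (simp flip: unit_ident_simps(4) add: unit_ident_inject)
  have "(\<forall>x. 0 \<le> x \<bullet> (unit_ident T *v x)) \<longleftrightarrow> (\<forall>x. 0 \<le> x \<bullet> (T *v x))"
  proof safe
    fix x assume *: "\<forall>x. 0 \<le> x \<bullet> (unit_ident T *v x)"
    have "x \<bullet> (T *v x) = (\<chi> i. x $ (1, i)) \<bullet> (unit_ident T *v (\<chi> i. x $ (1, i)))"
      by (simp add: inner_vec_def matrix_vector_mult_def sum_UNIV_1_prod)
    also have "\<dots> \<ge> 0" by (rule *[rule_format])
    finally show "0 \<le> x \<bullet> (T *v x)" .
  next
    fix x assume *: "\<forall>x. 0 \<le> x \<bullet> (T *v x)"
    have "x \<bullet> (unit_ident T *v x) = (\<chi> p. x $ snd p) \<bullet> (T *v (\<chi> p. x $ snd p))"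
      by (simp add: inner_vec_def matrix_vector_mult_def sum_UNIV_1_prod)
    also have "\<dots> \<ge> 0" by (rule *[rule_format])
    finally show "0 \<le> x \<bullet> (unit_ident T *v x)" .
  qed
  then show ?thesis using herm unfolding psd_iff by simp
qed

text \<open>The identification is an isomorphism of \<open>*\<close>-algebras that respects positivity, so by uniqueness of roots it
  commutes with taking them. This is what transfers the tensor product to \<open>d \<times> d\<close> matrices.\<close>

lemma unit_ident_psd_sqrt:
  assumes "psd T" shows "unit_ident (psd_sqrt T) = psd_sqrt (unit_ident T)"
  by (rule psd_sqrt_eqI[symmetric])
    (simp_all add: psd_unit_ident psd_sqrt[OF assms] flip: unit_ident_simps(1))

lemma invertible_unit_ident: "invertible (unit_ident T) \<longleftrightarrow> invertible T"
proof
  assume "invertible (unit_ident T)"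
  then obtain X where X: "unit_ident T ** X = mat 1" unfolding invertible_right_inverse by blast
  have "X = unit_ident ((mat 1 :: 1 cmat) \<otimes>\<^sub>m X)" by (simp add: unit_ident_kron)
  then have "T ** ((mat 1 :: 1 cmat) \<otimes>\<^sub>m X) = mat 1"
    using X by (simp add: unit_ident_simps flip: unit_ident_inject)
  then show "invertible T" unfolding invertible_right_inverse by blast
next
  assume "invertible T"
  then obtain X where "T ** X = mat 1" unfolding invertible_right_inverse by blast
  then have "unit_ident T ** unit_ident X = mat 1"
    unfolding unit_ident_simps(1)[symmetric] by (simp add: unit_ident_simps(5))
  then show "invertible (unit_ident T)" unfolding invertible_right_inverse by blast
qed

lemma unit_ident_matrix_inv:
  assumes "invertible T" shows "unit_ident (matrix_inv T) = matrix_inv (unit_ident T)"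
  by (rule matrix_inv_eqI[symmetric])
    (simp add: invertible_matrix_inv[OF assms] unit_ident_simps(5) flip: unit_ident_simps(1))

text \<open>A left inverse of the column \<open>(S, T)\<close> is exhibited wherever a tensor product or a \<open>\<star>\<close> has to be shown
  to be defined.\<close>

lemma mker_Int_trivial:
  assumes "P ** S + Q ** T = mat 1" shows "mker S \<inter> mker T = {0}"
proof -
  have "x = 0" if "S *v x = 0" "T *v x = 0" for x
  proof -
    have "x = (P ** S + Q ** T) *v x" by (simp add: assms)
    also have "\<dots> = P *v (S *v x) + Q *v (T *v x)"
      by (simp add: matrix_vector_mult_add_rdistrib matrix_vector_mul_assoc)
    finally show ?thesis using that by simp
  qed
  then show ?thesis by (auto simp: mker_def)
qed

text \<open>The square of the normalising operator \<open>K\<close>, polynomial in the real and imaginary parts of its arguments.\<close>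

definition gram :: "complex \<Rightarrow> complex \<Rightarrow> 'n::finite cmat \<Rightarrow> 'n cmat \<Rightarrow> 'n cmat" where
  "gram a b A B = mat (of_real ((cmod a)\<^sup>2)) ** (cadj A ** A) + mat (of_real ((cmod b)\<^sup>2)) ** (cadj B ** B)"

lemma gram_eq_cadj_mult:
  "gram a b A B = cadj (mat a ** A) ** (mat a ** A) + cadj (mat b ** B) ** (mat b ** B)"
proof -
  have *: "cadj (mat c ** X) ** (mat c ** X) = mat (of_real ((cmod c)\<^sup>2)) ** (cadj X ** X)" for c and X :: "'a cmat"
  proof -
    have "cadj (mat c ** X) ** (mat c ** X) = cadj X ** (mat (cnj c) ** (mat c ** X))"
      by (simp flip: matrix_mul_assoc)
    also have "\<dots> = mat (cnj c * c) ** (cadj X ** X)"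
      unfolding mat_mult_mat_assoc by (rule mult_mat_left_commute)
    also have "cnj c * c = of_real ((cmod c)\<^sup>2)" by (simp add: complex_norm_square mult.commute del: of_real_power)
    finally show ?thesis .
  qed
  show ?thesis unfolding * gram_def ..
qed

lemma psd_gram: "psd (gram a b A B)"
  unfolding gram_eq_cadj_mult by (intro psd_add psd_cadj_mult)

lemma invertible_of_injective: "(\<And>x. T *v x = 0 \<Longrightarrow> x = 0) \<Longrightarrow> invertible (T :: 'n::finite cmat)"
  unfolding invertible_left_inverse matrix_left_invertible_ker by blast

text \<open>The form of \<open>gram a b A B\<close> at \<open>x\<close> is \<open>\<parallel>aAx\<parallel>\<^sup>2 + \<parallel>bBx\<parallel>\<^sup>2\<close>, and \<open>Ax = Bx = 0\<close> forces
  \<open>x = A\<^sup>*Ax + B\<^sup>*Bx = 0\<close>.\<close>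

lemma invertible_gram:
  assumes "(A, B :: 'n::finite cmat) \<in> P_modules" "a \<noteq> 0" "b \<noteq> 0" shows "invertible (gram a b A B)"
proof (rule invertible_of_injective)
  fix x assume x: "gram a b A B *v x = 0"
  have "x \<bullet> (gram a b A B *v x) = norm ((mat a ** A) *v x) ^ 2 + norm ((mat b ** B) *v x) ^ 2"
    unfolding gram_eq_cadj_mult matrix_vector_mult_add_rdistrib inner_add_right inner_cadj_mult_self ..
  then have "(mat a ** A) *v x = 0" "(mat b ** B) *v x = 0" using x
    by (simp_all add: add_nonneg_eq_0_iff)
  then have "A *v x = 0" "B *v x = 0"
    using assms by (simp_all add: mat_vector_mult flip: matrix_vector_mul_assoc)
  moreover have "x = cadj A *v (A *v x) + cadj B *v (B *v x)"
    using assms(1) by (simp add: P_modules_def matrix_vector_mul_assoc flip: matrix_vector_mult_add_rdistrib)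
  ultimately show "x = 0" by simp
qed

abbreviation gram_root :: "complex \<Rightarrow> complex \<Rightarrow> 'n::finite cmat \<Rightarrow> 'n cmat \<Rightarrow> 'n cmat" where
  "gram_root a b A B \<equiv> psd_sqrt (gram a b A B)"

lemma cadj_mat_of_real_mult: "cadj (mat a) ** mat a = (mat (of_real ((cmod a)\<^sup>2)) :: 'n::finite cmat)"
  by (simp add: mat_mult_mat complex_norm_square mult.commute del: of_real_power)

text \<open>The identification of \<open>\<complex> \<otimes> \<complex>\<^sup>d\<close> with \<open>\<complex>\<^sup>d\<close> carries the operator under the root in the tensor product to
  \<open>gram a b A B\<close>.\<close>

lemma unit_tensor_eq:
  assumes AB: "(A, B) \<in> P_modules" and nz: "a \<noteq> 0" "b \<noteq> 0"
  shows "unit_tensor (mat a, mat b) (A, B) =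
    (mat a ** A ** matrix_inv (gram_root a b A B), mat b ** B ** matrix_inv (gram_root a b A B))"
proof -
  define G where "G = (mabs (mat a :: 1 cmat) ** mabs (mat a)) \<otimes>\<^sub>m (mabs A ** mabs A) +
      (mabs (mat b :: 1 cmat) ** mabs (mat b)) \<otimes>\<^sub>m (mabs B ** mabs B)"
  have G: "unit_ident G = gram a b A B"
    unfolding G_def mabs(2) unit_ident_simps unit_ident_kron gram_def cadj_mat_of_real_mult
    by simp
  have psd: "psd G" using psd_gram[of a b A B] by (simp add: psd_unit_ident flip: G)
  have inv: "invertible G" using invertible_gram[OF assms] by (simp add: invertible_unit_ident flip: G)
  have "unit_ident (matrix_inv (tensor_K (mat a, mat b) (A, B))) = matrix_inv (gram_root a b A B)"
    using psd inv unfolding tensor_K_def fst_conv snd_conv G_def[symmetric] G[symmetric]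
    by (simp add: unit_ident_matrix_inv unit_ident_psd_sqrt invertible_psd_sqrt)
  then show ?thesis
    unfolding unit_tensor_def pmod_tensor_def by (simp add: unit_ident_simps unit_ident_kron)
qed

lemma tensor_defined_unit:
  assumes AB: "(A, B) \<in> P_modules" and nz: "a \<noteq> 0" "b \<noteq> 0"
  shows "tensor_defined (mat a :: 1 cmat, mat b :: 1 cmat) (A, B)"
  unfolding tensor_defined_def fst_conv snd_conv
proof (rule mker_Int_trivial[of "(mat (1 / a) :: 1 cmat) \<otimes>\<^sub>m cadj A" _ "(mat (1 / b) :: 1 cmat) \<otimes>\<^sub>m cadj B"])
  have "mat (1 / c) ** cadj X ** (mat c ** X) = cadj X ** X" if "c \<noteq> 0" for c and X :: "'a cmat"
    unfolding matrix_mul_assoc[symmetric] mult_mat_left_commute[of "cadj X"] mat_mult_mat_assoc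
    using that by simp
  then have "mat (1 / a) ** cadj A ** (mat a ** A) + mat (1 / b) ** cadj B ** (mat b ** B) = mat 1"
    using AB nz by (simp add: P_modules_def)
  then show "(mat (1 / a) :: 1 cmat) \<otimes>\<^sub>m cadj A ** ((mat a :: 1 cmat) \<otimes>\<^sub>m A) +
     (mat (1 / b) :: 1 cmat) \<otimes>\<^sub>m cadj B ** ((mat b :: 1 cmat) \<otimes>\<^sub>m B) = mat 1"
    unfolding unit_ident_inject[symmetric] unit_ident_simps unit_ident_kron
    by simp
qed

section \<open>The action on P-modules\<close>

text \<open>On a P-module the operator under the root is a polynomial in \<open>A\<^sup>*A\<close>; this is the reason why all normalising
  operators of a module commute.\<close>

lemma gram_P_module:
  assumes "(A, B) \<in> P_modules"
  shows "gram a b A B = mat (of_real ((cmod b)\<^sup>2)) + mat (of_real ((cmod a)\<^sup>2 - (cmod b)\<^sup>2)) ** (cadj A ** A)"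
proof -
  have "cadj B ** B = mat 1 - cadj A ** A" using assms by (simp add: P_modules_def eq_diff_eq add.commute)
  then show ?thesis
    by (simp add: gram_def matrix_diff_ldistrib matrix_diff_rdistrib mat_diff[symmetric])
qed

lemma commute_gram_root:
  assumes AB: "(A, B) \<in> P_modules" and nz: "a \<noteq> 0" "b \<noteq> 0"
    and c: "C ** (cadj A ** A) = cadj A ** A ** C"
  shows "C ** gram_root a b A B = gram_root a b A B ** C"
proof (rule psd_sqrt_commute[OF psd_gram invertible_gram[OF AB nz]])
  show "C ** gram a b A B = gram a b A B ** C"
    unfolding gram_P_module[OF AB] matrix_add_ldistrib matrix_add_rdistrib
      mult_mat_commute[of C] mult_mat_left_commute[of C] c by (simp add: matrix_mul_assoc)
qed

lemma gram_root:
  assumes AB: "(A, B) \<in> P_modules" and nz: "a \<noteq> 0" "b \<noteq> 0"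
  shows "psd (gram_root a b A B)" "invertible (gram_root a b A B)"
    "gram_root a b A B ** gram_root a b A B = gram a b A B"
  using psd_gram[of a b A B] invertible_gram[OF assms] by (simp_all add: psd_sqrt invertible_psd_sqrt)

lemma gram_congruence:
  "gram a b (A ** X) (B ** X) = cadj X ** gram a b A B ** X"
  unfolding gram_eq_cadj_mult by (simp add: matrix_mul_assoc matrix_add_ldistrib matrix_add_rdistrib)

lemma gram_mat: "gram a b (mat c ** A) (mat d ** B) = gram (a * c) (b * d) A B"
  unfolding gram_eq_cadj_mult mat_mult_mat_assoc ..

lemma gram_1: "gram 1 1 A B = cadj A ** A + cadj B ** B"
  by (simp add: gram_def)

lemma P_modules_iff: "(A, B) \<in> P_modules \<longleftrightarrow> gram 1 1 A B = mat 1"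
  by (simp add: P_modules_def gram_1)

text \<open>For \<open>(A\<^sub>1, B\<^sub>1) = (aAK\<^sup>-\<^sup>1, bBK\<^sup>-\<^sup>1)\<close> the sum \<open>A\<^sub>1\<^sup>*A\<^sub>1 + B\<^sub>1\<^sup>*B\<^sub>1\<close> is \<open>K\<^sup>-\<^sup>1 K\<^sup>2 K\<^sup>-\<^sup>1\<close>.\<close>

lemma unit_tensor_closed:
  assumes X: "X \<in> P_modules" and nz: "a \<noteq> 0" "b \<noteq> 0"
  shows "unit_tensor (mat a, mat b) X \<in> P_modules"
proof -
  obtain A B where X_eq: "X = (A, B)" by (cases X)
  note AB = X[unfolded X_eq]
  define K where "K = gram_root a b A B"
  have K: "psd K" "invertible K" "K ** K = gram a b A B"
    using gram_root[OF AB nz] by (simp_all add: K_def)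
  have "gram 1 1 (mat a ** A ** matrix_inv K) (mat b ** B ** matrix_inv K) = matrix_inv K ** (K ** K) ** matrix_inv K"
    unfolding gram_congruence gram_mat by (simp add: K cadj_matrix_inv psdD)
  also have "\<dots> = mat 1"
    unfolding matrix_mul_assoc invertible_matrix_inv[OF K(2)] by (simp add: invertible_matrix_inv[OF K(2)])
  finally show ?thesis
    unfolding X_eq unit_tensor_eq[OF AB nz] P_modules_iff K_def .
qed

text \<open>A positive factor \<open>r\<close> of \<open>(a, b)\<close> also multiplies \<open>K\<close>, and cancels. Thus a product in
  \<open>Irr_diff1\<close> acts like the pair \<open>(ac, bd)\<close> before its normalisation.\<close>

lemma unit_tensor_scale:
  assumes X: "(X :: 'n::finite pmod) \<in> P_modules" and nz: "a \<noteq> 0" "b \<noteq> 0" and r: "r > 0"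
  shows "unit_tensor (mat (of_real r * a), mat (of_real r * b)) X = unit_tensor (mat a, mat b) X"
proof -
  obtain A B where X_eq: "X = (A, B)" by (cases X)
  note AB = X[unfolded X_eq]
  define K where "K = gram_root a b A B"
  have K: "psd K" "invertible K" "K ** K = gram a b A B"
    using gram_root[OF AB nz] by (simp_all add: K_def)
  have "gram_root (of_real r * a) (of_real r * b) A B = mat (of_real r) ** K"
  proof (rule psd_sqrt_eqI)
    have "mat (of_real r) ** K = cadj (mat (of_real (sqrt r))) ** K ** mat (of_real (sqrt r))"
      using r by (simp add: mult_mat_commute[of _ "of_real (sqrt r)"] mat_mult_mat_assoc flip: of_real_mult)
    then show "psd (mat (of_real r) ** K)" by (simp only: psd_congruence[OF K(1)])
    have "mat (of_real r) ** K ** (mat (of_real r) ** K) = mat (of_real r * of_real r) ** gram a b A B"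
      by (simp add: mult_mat_left_commute[of K] mat_mult_mat_assoc K(3) flip: matrix_mul_assoc)
    also have "\<dots> = gram (of_real r * a) (of_real r * b) A B"
      using r
      by (simp add: gram_def matrix_add_ldistrib mat_mult_mat_assoc norm_mult power_mult_distrib power2_eq_square mult_ac)
    finally show "mat (of_real r) ** K ** (mat (of_real r) ** K) = gram (of_real r * a) (of_real r * b) A B" .
  qed
  moreover have "matrix_inv (mat (of_real r) ** K) = mat (of_real (1 / r)) ** matrix_inv K"
    using r by (intro matrix_inv_eqI)
      (simp add: mat_mult_mat mult_mat_left_commute[of K] mat_mult_mat_assoc invertible_matrix_inv[OF K(2)] flip: matrix_mul_assoc)
  moreover have "mat (of_real r * c) ** Y ** (mat (of_real (1 / r)) ** matrix_inv K) = mat c ** Y ** matrix_inv K"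
    for c and Y :: "'n cmat"
    using r by (simp add: mult_mat_left_commute[of Y] mat_mult_mat_assoc flip: matrix_mul_assoc)
  ultimately show ?thesis
    using r nz unfolding X_eq by (simp add: unit_tensor_eq[OF AB] K_def)
qed

text \<open>Let \<open>K\<^sub>1\<close> and \<open>K\<^sub>3\<close> be the normalising operators of \<open>X\<close> for \<open>(c, d)\<close> and \<open>(ac, bd)\<close>. They commute, so
  \<open>K\<^sub>1\<^sup>-\<^sup>1 K\<^sub>3\<close> is positive, and its square is the operator under the root in the second step. Hence that
  step divides by \<open>K\<^sub>1\<^sup>-\<^sup>1 K\<^sub>3\<close>, and in total \<open>X\<close> is divided by \<open>K\<^sub>3\<close>.\<close>

lemma unit_tensor_compat:
  assumes X: "(X :: 'n::finite pmod) \<in> P_modules" and nz: "a \<noteq> 0" "b \<noteq> 0" "c \<noteq> 0" "d \<noteq> 0"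
  shows "unit_tensor (mat a, mat b) (unit_tensor (mat c, mat d) X) = unit_tensor (mat (a * c), mat (b * d)) X"
proof -
  obtain A B where X_eq: "X = (A, B)" by (cases X)
  note AB = X[unfolded X_eq]
  define K1 where "K1 = gram_root c d A B"
  define K3 where "K3 = gram_root (a * c) (b * d) A B"
  define A1 where "A1 = mat c ** A ** matrix_inv K1"
  define B1 where "B1 = mat d ** B ** matrix_inv K1"
  have K1: "psd K1" "invertible K1" "K1 ** K1 = gram c d A B"
    using gram_root[OF AB] nz by (simp_all add: K1_def)
  have K3: "psd K3" "invertible K3" "K3 ** K3 = gram (a * c) (b * d) A B"
    using gram_root[OF AB] nz by (simp_all add: K3_def)
  have "K1 ** (cadj A ** A) = cadj A ** A ** K1"
    unfolding K1_def using nz by (intro commute_gram_root[OF AB, symmetric]) auto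
  then have "K1 ** K3 = K3 ** K1"
    unfolding K3_def using nz by (intro commute_gram_root[OF AB]) auto
  then have comm: "K3 ** matrix_inv K1 = matrix_inv K1 ** K3"
    by (intro commute_matrix_inv[OF K1(2)]) simp
  have 1: "unit_tensor (mat c, mat d) X = (A1, B1)"
    unfolding X_eq A1_def B1_def K1_def using nz by (intro unit_tensor_eq[OF AB])
  then have AB1: "(A1, B1) \<in> P_modules" using unit_tensor_closed[OF X nz(3,4)] by simp
  have "gram_root a b A1 B1 = matrix_inv K1 ** K3"
  proof (rule psd_sqrt_eqI)
    show "psd (matrix_inv K1 ** K3)"
      using K1 K3 comm by (intro psd_mult_commuting psd_matrix_inv) auto
    have "matrix_inv K1 ** K3 ** (matrix_inv K1 ** K3) = matrix_inv K1 ** (K3 ** K3) ** matrix_inv K1"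
      unfolding comm[symmetric] by (simp add: matrix_mul_assoc) (simp add: comm flip: matrix_mul_assoc)
    also have "\<dots> = gram a b A1 B1"
      unfolding A1_def B1_def gram_congruence gram_mat K3(3) using K1 by (simp add: cadj_matrix_inv psdD)
    finally show "matrix_inv K1 ** K3 ** (matrix_inv K1 ** K3) = gram a b A1 B1" .
  qed
  moreover have "matrix_inv (matrix_inv K1 ** K3) = matrix_inv K3 ** K1"
  proof (rule matrix_inv_eqI)
    have "matrix_inv K1 ** K3 ** (matrix_inv K3 ** K1) = matrix_inv K1 ** (K3 ** matrix_inv K3) ** K1"
      by (simp add: matrix_mul_assoc)
    then show "matrix_inv K1 ** K3 ** (matrix_inv K3 ** K1) = mat 1"
      by (simp add: invertible_matrix_inv[OF K1(2)] invertible_matrix_inv[OF K3(2)])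
  qed
  moreover have "mat e ** (mat f ** Y ** matrix_inv K1) ** (matrix_inv K3 ** K1) = mat (e * f) ** Y ** matrix_inv K3"
    for e f and Y :: "'n cmat"
  proof -
    have "matrix_inv K1 ** matrix_inv K3 = matrix_inv K3 ** matrix_inv K1"
      using comm by (intro commute_matrix_inv[OF K3(2)]) simp
    then have "matrix_inv K1 ** (matrix_inv K3 ** K1) = matrix_inv K3 ** (matrix_inv K1 ** K1)"
      by (simp add: matrix_mul_assoc)
    then have "matrix_inv K1 ** (matrix_inv K3 ** K1) = matrix_inv K3"
      by (simp add: invertible_matrix_inv[OF K1(2)])
    then show ?thesis by (simp add: mat_mult_mat_assoc flip: matrix_mul_assoc)
  qed
  ultimately have "unit_tensor (mat a, mat b) (A1, B1) =
      (mat (a * c) ** A ** matrix_inv K3, mat (b * d) ** B ** matrix_inv K3)"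
    unfolding unit_tensor_eq[OF AB1 nz(1,2)] by (simp add: A1_def B1_def)
  moreover have "unit_tensor (mat (a * c), mat (b * d)) X =
      (mat (a * c) ** A ** matrix_inv K3, mat (b * d) ** B ** matrix_inv K3)"
    unfolding X_eq K3_def using nz by (intro unit_tensor_eq[OF AB]) auto
  ultimately show ?thesis unfolding 1 by simp
qed

lemma unit_tensor_1:
  assumes "X \<in> P_modules" shows "unit_tensor (mat 1, mat 1) X = X"
proof -
  obtain A B where X_eq: "X = (A, B)" by (cases X)
  have "gram_root 1 1 A B = mat 1"
    using assms psd_mat[of 1] by (intro psd_sqrt_eqI) (simp_all add: X_eq P_modules_iff)
  then show ?thesis
    using assms unit_tensor_eq[of A B 1 1] by (simp add: X_eq matrix_inv_mat)
qed

lemma carrier_Irr_iff: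
  "(mat a, mat b) \<in> carrier Irr_diff1 \<longleftrightarrow> (cmod a)\<^sup>2 + (cmod b)\<^sup>2 = 1 \<and> a \<noteq> 0 \<and> b \<noteq> 0"
  by (auto simp: Irr_diff1_def)

lemma carrier_IrrE:
  assumes "g \<in> carrier Irr_diff1"
  obtains a b where "g = (mat a, mat b)" "(cmod a)\<^sup>2 + (cmod b)\<^sup>2 = 1" "a \<noteq> 0" "b \<noteq> 0"
  using assms by (auto simp: Irr_diff1_def)

lemma mat_in_P_modules: "(mat a, mat b) \<in> (P_modules :: 'n::finite pmod set) \<longleftrightarrow> (cmod a)\<^sup>2 + (cmod b)\<^sup>2 = 1"
proof -
  have "cadj (mat a) ** mat a + cadj (mat b) ** mat b = (mat (of_real ((cmod a)\<^sup>2 + (cmod b)\<^sup>2)) :: 'n cmat)"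
    unfolding cadj_mat_of_real_mult mat_add by simp
  then show ?thesis by (simp add: P_modules_def del: of_real_add)
qed

text \<open>\<open>Irr_diff1\<close> is an open part of the P-modules over \<open>\<complex>\<close>. All statements about P-modules therefore apply to its
  elements, and it inherits their submanifold structure.\<close>

lemma carrier_Irr_eq: "carrier Irr_diff1 = P_modules \<inter> {g. fst g $ 1 $ 1 \<noteq> 0 \<and> snd g $ 1 $ 1 \<noteq> 0}"
proof safe
  fix S T :: "1 cmat" assume *: "(S, T) \<in> P_modules" "fst (S, T) $ 1 $ 1 \<noteq> 0" "snd (S, T) $ 1 $ 1 \<noteq> 0"
  then have "(mat (S $ 1 $ 1), mat (T $ 1 $ 1)) \<in> carrier Irr_diff1"
    unfolding carrier_Irr_iff mat_in_P_modules[where 'n = 1, symmetric] by (simp add: cmat_1_eq)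
  then show "(S, T) \<in> carrier Irr_diff1" by (simp add: cmat_1_eq)
next
  fix S T :: "1 cmat" assume "(S, T) \<in> carrier Irr_diff1"
  then obtain a b where *: "(S, T) = (mat a, mat b)" "(cmod a)\<^sup>2 + (cmod b)\<^sup>2 = 1" "a \<noteq> 0" "b \<noteq> 0"
    by (rule carrier_IrrE)
  show "(S, T) \<in> P_modules" unfolding *(1) mat_in_P_modules by (rule *(2))
  show "fst (S, T) $ 1 $ 1 = 0 \<Longrightarrow> False" "snd (S, T) $ 1 $ 1 = 0 \<Longrightarrow> False"
    unfolding *(1) using *(3,4) by simp_all
qed

lemma unit_tensor_mat:
  assumes nz: "a \<noteq> 0" "b \<noteq> 0" "c \<noteq> 0" "d \<noteq> 0" and cd: "(cmod c)\<^sup>2 + (cmod d)\<^sup>2 = 1"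
  defines "s \<equiv> sqrt ((cmod (a * c))\<^sup>2 + (cmod (b * d))\<^sup>2)"
  shows "unit_tensor (mat a, mat b) (mat c :: 'n::finite cmat, mat d) =
      (mat (of_real (1 / s) * (a * c)), mat (of_real (1 / s) * (b * d)))"
    and "s > 0"
proof -
  show s: "s > 0" using nz by (simp add: s_def add_pos_pos)
  have ss: "(cmod (a * c))\<^sup>2 + (cmod (b * d))\<^sup>2 = s * s" by (simp add: s_def)
  have "gram a b (mat c :: 'n cmat) (mat d) = mat (of_real s) ** mat (of_real s)"
    unfolding gram_eq_cadj_mult mat_mult_mat cadj_mat_of_real_mult mat_add of_real_add[symmetric] ss
    by simp
  then have "gram_root a b (mat c :: 'n cmat) (mat d) = mat (of_real s)"
    using s by (intro psd_sqrt_eqI psd_mat) auto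
  moreover have "matrix_inv (mat (of_real s) :: 'n cmat) = mat (of_real (1 / s))"
    using s by (simp add: matrix_inv_mat)
  ultimately show "unit_tensor (mat a, mat b) (mat c :: 'n cmat, mat d) =
      (mat (of_real (1 / s) * (a * c)), mat (of_real (1 / s) * (b * d)))"
    using cd nz by (subst unit_tensor_eq) (simp_all add: mat_in_P_modules mat_mult_mat mult.commute)
qed

lemma Irr_simps:
  "monoid.mult Irr_diff1 g h = unit_tensor g h"
  "one Irr_diff1 = (mat (of_real (1 / sqrt 2)), mat (of_real (1 / sqrt 2)))"
  by (simp_all add: Irr_diff1_def)

lemma unit_tensor_one: "X \<in> P_modules \<Longrightarrow> unit_tensor (one Irr_diff1) X = X"
  using unit_tensor_scale[of X 1 1 "1 / sqrt 2"] by (simp add: Irr_simps unit_tensor_1 del: of_real_divide)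

text \<open>The product of \<open>g = (a, b)\<close> and \<open>h = (c, d)\<close> is a positive multiple of \<open>(ac, bd)\<close>.\<close>

lemma unit_tensor_mult:
  assumes g: "g \<in> carrier Irr_diff1" and h: "h \<in> carrier Irr_diff1" and X: "X \<in> P_modules"
  shows "unit_tensor (monoid.mult Irr_diff1 g h) X = unit_tensor g (unit_tensor h X)"
  using g
proof (rule carrier_IrrE)
  fix a b assume g_eq: "g = (mat a, mat b)" and nz: "a \<noteq> 0" "b \<noteq> 0"
  show ?thesis using h
  proof (rule carrier_IrrE)
    fix c d assume h_eq: "h = (mat c, mat d)" and cd: "(cmod c)\<^sup>2 + (cmod d)\<^sup>2 = 1" and nz': "c \<noteq> 0" "d \<noteq> 0"
    show ?thesis
      unfolding g_eq h_eq Irr_simps unit_tensor_compat[OF X nz nz'] unit_tensor_mat(1)[OF nz nz' cd]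
      using nz nz' unit_tensor_mat(2)[OF nz nz' cd] by (intro unit_tensor_scale[OF X]) simp_all
  qed
qed

lemma unit_tensor_Irr_closed:
  assumes "g \<in> carrier Irr_diff1" "X \<in> P_modules" shows "unit_tensor g X \<in> P_modules"
  using assms by (auto elim!: carrier_IrrE intro!: unit_tensor_closed)

text \<open>Since \<open>|a|\<^sup>2 + |b|\<^sup>2 = 1\<close>, the vector \<open>(1/a, 1/b)\<close> has norm \<open>1 / |ab|\<close>; the factor \<open>r = |ab|\<close> normalises it.\<close>

definition Irr_inv :: "1 pmod \<Rightarrow> 1 pmod" where
  "Irr_inv g = (let a = fst g $ 1 $ 1; b = snd g $ 1 $ 1; r = of_real (cmod a * cmod b)
    in (mat (r * (1 / a)), mat (r * (1 / b))))"

lemma Irr_inv: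
  assumes "g \<in> carrier Irr_diff1"
  shows "Irr_inv g \<in> carrier Irr_diff1" "unit_tensor (Irr_inv g) g = one Irr_diff1"
proof -
  obtain a b where g: "g = (mat a, mat b)" and ab: "(cmod a)\<^sup>2 + (cmod b)\<^sup>2 = 1" and nz: "a \<noteq> 0" "b \<noteq> 0"
    using assms by (rule carrier_IrrE)
  define r where "r = cmod a * cmod b"
  have r: "r > 0" using nz by (simp add: r_def)
  have inv: "Irr_inv g = (mat (of_real r * (1 / a)), mat (of_real r * (1 / b)))"
    by (simp add: Irr_inv_def g r_def Let_def)
  show "Irr_inv g \<in> carrier Irr_diff1"
    unfolding inv carrier_Irr_iff using nz r ab
    by (simp add: norm_mult norm_divide power_mult_distrib power_divide r_def add.commute)
  have "g \<in> P_modules" by (simp add: g mat_in_P_modules ab)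
  then have "unit_tensor (Irr_inv g) g = unit_tensor (mat (1 / a), mat (1 / b)) g"
    unfolding inv using nz r by (intro unit_tensor_scale) auto
  also have "\<dots> = one Irr_diff1"
    using nz ab unfolding g by (subst unit_tensor_mat) (simp_all add: Irr_simps)
  finally show "unit_tensor (Irr_inv g) g = one Irr_diff1" .
qed

lemma group_Irr: "group Irr_diff1"
proof (rule groupI)
  fix g h k assume gh: "g \<in> carrier Irr_diff1" "h \<in> carrier Irr_diff1"
  obtain a b c d where *: "g = (mat a, mat b)" "h = (mat c, mat d)" "a \<noteq> 0" "b \<noteq> 0" "c \<noteq> 0" "d \<noteq> 0"
    "(cmod c)\<^sup>2 + (cmod d)\<^sup>2 = 1" using gh by (auto elim!: carrier_IrrE)
  have P: "unit_tensor g h \<in> P_modules" using gh unit_tensor_Irr_closed carrier_Irr_eq by blast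
  show "monoid.mult Irr_diff1 g h \<in> carrier Irr_diff1"
    using P * unit_tensor_mat(2)[OF *(3-7)] unfolding *(1,2) Irr_simps unit_tensor_mat(1)[OF *(3-7)] carrier_Irr_iff mat_in_P_modules
    by simp
  assume k: "k \<in> carrier Irr_diff1"
  show "monoid.mult Irr_diff1 (monoid.mult Irr_diff1 g h) k = monoid.mult Irr_diff1 g (monoid.mult Irr_diff1 h k)"
    using unit_tensor_mult[OF gh, of k] k by (simp add: Irr_simps carrier_Irr_eq)
next
  show "one Irr_diff1 \<in> carrier Irr_diff1"
    unfolding Irr_simps carrier_Irr_iff by (simp add: norm_divide power_divide)
next
  fix g assume g: "g \<in> carrier Irr_diff1"
  show "monoid.mult Irr_diff1 (one Irr_diff1) g = g"
    using g unit_tensor_one[of g] by (simp add: Irr_simps carrier_Irr_eq)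
  show "\<exists>h\<in>carrier Irr_diff1. monoid.mult Irr_diff1 h g = one Irr_diff1"
    using Irr_inv[OF g] by (auto simp: Irr_simps(1))
qed

lemma inv_Irr: "g \<in> carrier Irr_diff1 \<Longrightarrow> m_inv Irr_diff1 g = Irr_inv g"
  using Irr_inv[of g] group.inv_equality[OF group_Irr, of "Irr_inv g" g] by (simp add: Irr_simps(1))

text \<open>Each \<open>f g\<close> is a bijection because \<open>f (inv g)\<close> is its inverse.\<close>

lemma group_action_restrictI:
  assumes "group G"
    and closed: "\<And>g x. g \<in> carrier G \<Longrightarrow> x \<in> E \<Longrightarrow> f g x \<in> E"
    and one: "\<And>x. x \<in> E \<Longrightarrow> f (one G) x = x"
    and mult: "\<And>g h x. g \<in> carrier G \<Longrightarrow> h \<in> carrier G \<Longrightarrow> x \<in> E \<Longrightarrow> f (monoid.mult G g h) x = f g (f h x)"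
  shows "group_action G E (\<lambda>g. restrict (f g) E)"
proof -
  interpret G: group G by fact
  have inverse: "f (m_inv G g) (f g x) = x" "f g (f (m_inv G g) x) = x" if "g \<in> carrier G" "x \<in> E" for g x
    using that by (simp_all add: one flip: mult)
  have Bij: "restrict (f g) E \<in> Bij E" if "g \<in> carrier G" for g
  proof -
    have "bij_betw (f g) E E"
      using that by (intro bij_betwI[where g = "f (m_inv G g)"]) (auto simp: closed inverse)
    then show ?thesis by (simp add: Bij_def)
  qed
  have "(\<lambda>g. restrict (f g) E) \<in> hom G (BijGroup E)"
  proof (rule homI)
    fix g h assume gh: "g \<in> carrier G" "h \<in> carrier G"
    show "restrict (f g) E \<in> carrier (BijGroup E)" using Bij gh by (simp add: BijGroup_def)
    show "restrict (f (monoid.mult G g h)) E = monoid.mult (BijGroup E) (restrict (f g) E) (restrict (f h) E)"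
      using Bij gh by (auto simp: BijGroup_def compose_def fun_eq_iff mult closed)
  qed
  then show ?thesis
    unfolding group_action_def group_hom_def group_hom_axioms_def
    using group_BijGroup[of E] \<open>group G\<close> by simp
qed

text \<open>The restrictions agree because \<open>P_action\<close> is itself a restriction to the larger set of all P-modules.\<close>

lemma group_action_unit_tensor:
  assumes "E \<subseteq> P_modules" "\<And>g X. g \<in> carrier Irr_diff1 \<Longrightarrow> X \<in> E \<Longrightarrow> unit_tensor g X \<in> E"
  shows "group_action Irr_diff1 E (\<lambda>g. restrict (P_action g) E)"
proof -
  have "(\<lambda>g. restrict (P_action g) E) = (\<lambda>g. restrict (unit_tensor g) E)"
    using assms(1) by (auto simp: P_action_def fun_eq_iff)
  moreover have "group_action Irr_diff1 E (\<lambda>g. restrict (unit_tensor g) E)"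
    using assms by (intro group_action_restrictI group_Irr)
      (auto simp: unit_tensor_mult subset_iff unit_tensor_one simp del: Irr_simps)
  ultimately show ?thesis by simp
qed

lemma group_action_P: "group_action Irr_diff1 (P_modules :: 'n::finite pmod set) P_action"
proof -
  have "(\<lambda>g. restrict (P_action g) (P_modules :: 'n pmod set)) = P_action"
    by (simp add: P_action_def fun_eq_iff)
  moreover have "group_action Irr_diff1 (P_modules :: 'n pmod set) (\<lambda>g. restrict (P_action g) P_modules)"
    by (rule group_action_unit_tensor) (auto intro: unit_tensor_Irr_closed)
  ultimately show ?thesis by simp
qed

text \<open>Up to the factor \<open>|a|\<^sup>2\<close>, both products of \<open>aAK\<close> with its adjoint are \<open>K (A\<^sup>*A) K\<close>.\<close>

lemma normal_mult_commuting:
  assumes "normal_mat A" "psd K" "A ** K = K ** A" shows "normal_mat (mat a ** A ** (K :: 'n::finite cmat))"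
proof -
  have K: "cadj K = K" using assms by (simp add: psdD)
  have c: "K ** cadj A = cadj A ** K" using arg_cong[OF assms(3), of cadj] by (simp add: K)
  have "normal_mat (A ** K)"
  proof -
    have "A ** K ** (K ** cadj A) = K ** A ** (cadj A ** K)" by (simp only: assms(3) c)
    also have "\<dots> = K ** (A ** cadj A) ** K" by (simp add: matrix_mul_assoc)
    also have "\<dots> = K ** (cadj A ** A) ** K" using assms(1) by (simp add: normal_mat_def)
    also have "\<dots> = K ** cadj A ** (A ** K)" by (simp add: matrix_mul_assoc)
    finally show ?thesis by (simp add: normal_mat_def K)
  qed
  moreover have "normal_mat (mat a ** N)" if "normal_mat N" for N :: "'n cmat"
  proof -
    have "cadj (mat a ** N) ** (mat a ** N) = mat (cnj a * a) ** (cadj N ** N)"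
      by (simp add: mult_mat_left_commute[of "cadj N"] mult_mat_commute[of "cadj N"] mat_mult_mat_assoc flip: matrix_mul_assoc)
    moreover have "(mat a ** N) ** cadj (mat a ** N) = mat (cnj a * a) ** (N ** cadj N)"
      by (simp add: mult_mat_left_commute[of N] mult_mat_commute[of "cadj N"] mat_mult_mat_assoc mult.commute flip: matrix_mul_assoc)
    ultimately show ?thesis using that by (simp add: normal_mat_def)
  qed
  ultimately show ?thesis by (simp flip: matrix_mul_assoc)
qed

lemma unit_tensor_preserves:
  assumes g: "g \<in> carrier Irr_diff1" and AB: "(A, B) \<in> P_modules" and eq: "unit_tensor g (A, B) = (A', B')"
  shows "normal_mat A \<Longrightarrow> normal_mat A'" "invertible A \<Longrightarrow> invertible A'" "invertible B \<Longrightarrow> invertible B'"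
proof -
  obtain a b where g_eq: "g = (mat a, mat b)" and nz: "a \<noteq> 0" "b \<noteq> 0"
    using g by (rule carrier_IrrE)
  define K where "K = gram_root a b A B"
  have K: "psd K" "invertible K" using gram_root[OF AB nz] by (simp_all add: K_def)
  have AB': "A' = mat a ** A ** matrix_inv K" "B' = mat b ** B ** matrix_inv K"
    using eq unfolding g_eq unit_tensor_eq[OF AB nz] K_def by auto
  show "invertible A \<Longrightarrow> invertible A'" "invertible B \<Longrightarrow> invertible B'"
    unfolding AB' using nz K by (auto intro!: invertible_mult invertible_mat matrix_inv_invertible)
  assume n: "normal_mat A"
  have "A ** K = K ** A"
    unfolding K_def
  proof (rule commute_gram_root[OF AB nz])
    show "A ** (cadj A ** A) = cadj A ** A ** A"
      using n unfolding matrix_mul_assoc normal_mat_def by simp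
  qed
  then show "normal_mat A'"
    unfolding AB' by (intro normal_mult_commuting n psd_matrix_inv K commute_matrix_inv)
qed

lemma group_action_M: "group_action Irr_diff1 M_modules (\<lambda>g. restrict (P_action g) M_modules)"
proof (rule group_action_unit_tensor)
  fix g and X :: "'a pmod" assume g: "g \<in> carrier Irr_diff1" and X: "X \<in> M_modules"
  obtain A B A' B' where *: "X = (A, B)" "unit_tensor g X = (A', B')" by (metis surj_pair)
  show "unit_tensor g X \<in> M_modules"
    using X *(2)[unfolded *(1)] unit_tensor_preserves[OF g, of A B A' B'] unit_tensor_Irr_closed[OF g, of X] *
    by (simp add: M_modules_def)
qed (auto simp: M_modules_def)

lemma group_action_N: "group_action Irr_diff1 N_modules (\<lambda>g. restrict (P_action g) N_modules)"
proof (rule group_action_unit_tensor)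
  fix g and X :: "'a pmod" assume g: "g \<in> carrier Irr_diff1" and X: "X \<in> N_modules"
  obtain A B A' B' where *: "X = (A, B)" "unit_tensor g X = (A', B')" by (metis surj_pair)
  show "unit_tensor g X \<in> N_modules"
    using X *(2)[unfolded *(1)] unit_tensor_preserves[OF g, of A B A' B'] unit_tensor_Irr_closed[OF g, of X] *
    by (simp add: N_modules_def)
qed (auto simp: N_modules_def)

section \<open>Polar decompositions\<close>

lemma P_modules_swap: "(A, B) \<in> P_modules \<Longrightarrow> (B, A) \<in> P_modules"
  by (simp add: P_modules_def add.commute)

lemma gram_swap: "gram a b A B = gram b a B A"
  by (simp add: gram_def add.commute)

text \<open>From \<open>\<parallel>|A| x\<parallel> = \<parallel>Ax\<parallel> \<le> \<parallel>x\<parallel>\<close> and the Cauchy-Schwarz inequality, \<open>x \<bullet> |A| x \<le> \<parallel>x\<parallel>\<^sup>2\<close>.\<close>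

lemma psd_one_minus_mabs:
  assumes "(A, B) \<in> P_modules" shows "psd (mat 1 - mabs A)"
  unfolding psd_iff
proof (intro conjI allI)
  show "cadj (mat 1 - mabs A) = mat 1 - mabs A" by (simp add: psdD mabs)
  fix x
  have "norm (mabs A *v x) ^ 2 = norm (A *v x) ^ 2"
    using inner_cadj_mult_self[of x "mabs A"] inner_cadj_mult_self[of x A] by (simp add: psdD mabs)
  also have "\<dots> \<le> x \<bullet> ((cadj A ** A + cadj B ** B) *v x)"
    by (simp add: matrix_vector_mult_add_rdistrib inner_add_right inner_cadj_mult_self)
  also have "\<dots> = norm x ^ 2" using assms by (simp add: P_modules_def power2_norm_eq_inner)
  finally have le: "norm (mabs A *v x) \<le> norm x" by (simp add: power2_le_iff_abs_le)
  have "x \<bullet> (mabs A *v x) \<le> norm x * norm (mabs A *v x)" by (rule norm_cauchy_schwarz)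
  also have "\<dots> \<le> norm x * norm x" using le by (intro mult_left_mono) auto
  finally show "0 \<le> x \<bullet> ((mat 1 - mabs A) *v x)"
    by (simp add: matrix_vector_mult_diff_rdistrib inner_diff_right power2_norm_eq_inner[symmetric] power2_eq_square)
qed

lemma cmod_less_1: "(cmod a)\<^sup>2 + (cmod b)\<^sup>2 = 1 \<Longrightarrow> b \<noteq> 0 \<Longrightarrow> cmod a < 1"
  by (smt (verit) norm_ge_zero one_le_power power2_less_eq_zero_iff zero_less_norm_iff zero_less_power)

text \<open>The scalar \<open>|a|\<close> lies strictly between \<open>0\<close> and \<open>1\<close>, so the two kernels are those of \<open>|A|\<close> and \<open>1 - |A|\<close>,
  two operators with sum \<open>1\<close>.\<close>

lemma star_defined_mabs:
  assumes AB: "(A, B) \<in> P_modules" and ab: "(cmod a)\<^sup>2 + (cmod b)\<^sup>2 = 1" and nz: "a \<noteq> 0" "b \<noteq> 0"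
  shows "star_defined (mat (of_real (cmod a)) :: 1 cmat) (mabs A)"
  unfolding star_defined_def
proof (intro conjI)
  have r: "0 < cmod a" "cmod a < 1" using cmod_less_1[OF ab nz(2)] nz by auto
  show "psd (mat (of_real (cmod a)) :: 1 cmat)" by (simp add: psd_mat)
  show "psd (mat 1 - mat (of_real (cmod a)) :: 1 cmat)"
    using psd_mat[of "1 - cmod a"] r by (simp add: mat_diff)
  show "psd (mabs A)" by (rule mabs)
  show "psd (mat 1 - mabs A)" using AB by (rule psd_one_minus_mabs)
  have c: "complex_of_real (cmod a) \<noteq> 0" "1 - complex_of_real (cmod a) \<noteq> 0"
    using r by (auto simp: complex_eq_iff)
  show "mker ((mat (of_real (cmod a)) :: 1 cmat) \<otimes>\<^sub>m mabs A) \<inter>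
      mker ((mat 1 - mat (of_real (cmod a)) :: 1 cmat) \<otimes>\<^sub>m (mat 1 - mabs A)) = {0}"
    using c by (intro mker_Int_trivial[of "(mat (1 / of_real (cmod a)) :: 1 cmat) \<otimes>\<^sub>m mat 1" _
          "(mat (1 / (1 - of_real (cmod a))) :: 1 cmat) \<otimes>\<^sub>m mat 1"])
      (simp add: unit_ident_simps unit_ident_kron mat_diff mat_mult_mat_assoc flip: unit_ident_inject)
qed

text \<open>Because \<open>1 - |a|\<^sup>2 = |b|\<^sup>2\<close> and \<open>1 - |A|\<^sup>2 = |B|\<^sup>2\<close>, the operator under the root in \<open>|a| \<star> |A|\<close> is
  \<open>gram a b A B\<close>.\<close>

lemma scalar_star_mabs:
  assumes AB: "(A, B) \<in> P_modules" and ab: "(cmod a)\<^sup>2 + (cmod b)\<^sup>2 = 1" and nz: "a \<noteq> 0" "b \<noteq> 0"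
  shows "scalar_star (cmod a) (mabs A) = mat (of_real (cmod a)) ** mabs A ** matrix_inv (gram_root a b A B)"
proof -
  define P where "P = (mat (of_real (cmod a)) :: 1 cmat)"
  define G where "G = (P ** P) \<otimes>\<^sub>m (mabs A ** mabs A) + (mat 1 - P ** P) \<otimes>\<^sub>m (mat 1 - mabs A ** mabs A)"
  have "mat 1 - mabs A ** mabs A = cadj B ** B"
    using AB by (simp add: P_modules_def mabs diff_eq_eq add.commute)
  moreover have "1 - (cmod a)\<^sup>2 = (cmod b)\<^sup>2" using ab by simp
  then have "1 - complex_of_real (cmod a) * complex_of_real (cmod a) = of_real ((cmod b)\<^sup>2)"
    by (metis of_real_1 of_real_diff of_real_mult power2_eq_square)
  ultimately have G: "unit_ident G = gram a b A B"
    unfolding G_def P_def unit_ident_simps unit_ident_kron mat_mult_mat mat_diff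
    by (simp add: gram_def mabs power2_eq_square)
  have psd: "psd G" using psd_gram[of a b A B] by (simp add: psd_unit_ident flip: G)
  have inv: "invertible G" using invertible_gram[OF AB nz] by (simp add: invertible_unit_ident flip: G)
  have "unit_ident (matrix_inv (psd_sqrt G)) = matrix_inv (gram_root a b A B)"
    using psd inv unfolding G[symmetric]
    by (simp add: unit_ident_matrix_inv unit_ident_psd_sqrt invertible_psd_sqrt)
  then show ?thesis
    unfolding scalar_star_def star_def P_def[symmetric] G_def[symmetric]
    by (simp add: unit_ident_simps unit_ident_kron) (simp add: P_def)
qed

lemma polar_scalar_star:
  assumes AB: "(A, B) \<in> P_modules" and ab: "(cmod a)\<^sup>2 + (cmod b)\<^sup>2 = 1" and nz: "a \<noteq> 0" "b \<noteq> 0"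
    and U: "polar_unitary A U" and t: "is_Arg a t"
  shows "mat (exp (\<i> * of_real t)) ** U ** scalar_star (cmod a) (mabs A) =
    mat a ** A ** matrix_inv (gram_root a b A B)"
proof -
  have A: "A = U ** mabs A" using U by (simp add: polar_unitary_def)
  have a: "exp (\<i> * of_real t) * of_real (cmod a) = a"
    using t by (simp add: is_Arg_def mult.commute)
  have "mat (exp (\<i> * of_real t)) ** U ** scalar_star (cmod a) (mabs A) =
      mat (exp (\<i> * of_real t)) ** (mat (of_real (cmod a)) ** (U ** (mabs A ** matrix_inv (gram_root a b A B))))"
    unfolding scalar_star_mabs[OF AB ab nz] by (simp add: mult_mat_left_commute[of U] flip: matrix_mul_assoc)
  also have "\<dots> = mat a ** (U ** mabs A) ** matrix_inv (gram_root a b A B)"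
    unfolding mat_mult_mat_assoc a by (simp add: matrix_mul_assoc)
  finally show ?thesis by (simp only: A[symmetric])
qed

section \<open>Smoothness of the square root\<close>

lemma inner_left_mult: "(X :: 'n::finite cmat) \<bullet> (S ** Y) = (cadj S ** X) \<bullet> Y"
  by (simp add: inner_matrix_columns column_matrix_mult inner_matrix_vector)

lemma bounded_linear_mult_left: "bounded_linear (\<lambda>X. (S :: 'n::finite cmat) ** (X :: 'n cmat))"
  by (rule bounded_bilinear.bounded_linear_right[OF bounded_bilinear_matrix_mult])

lemma bounded_linear_mult_right: "bounded_linear (\<lambda>X. (X :: 'n cmat) ** (S :: 'n::finite cmat))"
  by (rule bounded_bilinear.bounded_linear_left[OF bounded_bilinear_matrix_mult])

lemma norm_matrix_mult_bound:
  obtains C where "C > 0" "\<And>(X :: 'n::finite cmat) (Y :: 'n cmat). norm (X ** Y) \<le> norm X * norm Y * C"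
proof -
  from bounded_bilinear.pos_bounded[OF bounded_bilinear_matrix_mult]
  obtain C where "C > 0" "\<forall>(X :: 'n cmat) (Y :: 'n cmat). norm (X ** Y) \<le> norm X * norm Y * C" by (elim exE conjE)
  then show thesis by (intro that[of C]) auto
qed

text \<open>With \<open>R\<close> the root of \<open>S\<close>, the pairing is \<open>\<parallel>RX\<parallel>\<^sup>2\<close>, and \<open>X = R\<^sup>-\<^sup>1 (RX)\<close> is bounded by a multiple of \<open>RX\<close>.\<close>

lemma psd_lower_bound:
  assumes S: "psd S" "invertible (S :: 'n::finite cmat)"
  obtains m where "m > 0" "\<And>X :: 'n cmat. m * (norm X)\<^sup>2 \<le> X \<bullet> (S ** X)"
proof -
  define R where "R = psd_sqrt S"
  have R: "cadj R = R" "R ** R = S" "invertible R"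
    using S by (simp_all add: R_def psd_sqrt invertible_psd_sqrt psdD)
  obtain C where C: "C > 0" "\<And>Y :: 'n cmat. norm (matrix_inv R ** Y) \<le> norm Y * C"
    using bounded_linear.pos_bounded[OF bounded_linear_mult_left] by blast
  have "(1 / C\<^sup>2) * (norm X)\<^sup>2 \<le> X \<bullet> (S ** X)" for X :: "'n cmat"
  proof -
    have "norm X \<le> norm (R ** X) * C"
      using C(2)[of "R ** X"] by (simp add: matrix_mul_assoc invertible_matrix_inv[OF R(3)])
    then have "(norm X)\<^sup>2 \<le> (norm (R ** X) * C)\<^sup>2" by (intro power_mono) auto
    also have "\<dots> = (X \<bullet> (S ** X)) * C\<^sup>2"
      by (simp add: power_mult_distrib power2_norm_eq_inner inner_left_mult R flip: R(2) matrix_mul_assoc)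
    finally show ?thesis using C(1) by (simp add: field_simps)
  qed
  then show thesis using C(1) by (intro that[of "1 / C\<^sup>2"]) auto
qed

text \<open>The constant \<open>m\<close> does not depend on \<open>S\<^sup>\<prime>\<close>. This uniformity allows a comparison of the roots at two
  different points when only one of the two is known to be invertible.\<close>

lemma sylvester_lower_bound:
  assumes S: "psd S" "invertible (S :: 'n::finite cmat)"
  obtains m where "m > 0" "\<And>(X :: 'n cmat) S'. psd S' \<Longrightarrow> m * norm X \<le> norm (S ** X + X ** S')"
proof -
  obtain m where m: "m > 0" "\<And>X :: 'n cmat. m * (norm X)\<^sup>2 \<le> X \<bullet> (S ** X)" using psd_lower_bound[OF S] by blast
  have "m * norm X \<le> norm (S ** X + X ** S')" if S': "psd S'" for X S' :: "'n cmat"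
  proof (cases "X = 0")
    case False
    have "norm X * (m * norm X) \<le> X \<bullet> (S ** X + X ** S')"
      using m(2)[of X] inner_right_mult_nonneg[OF S', of X]
      by (simp add: inner_add_right power2_eq_square mult_ac)
    also have "\<dots> \<le> norm X * norm (S ** X + X ** S')" by (rule norm_cauchy_schwarz)
    finally show ?thesis using False by simp
  qed simp
  with m(1) that show thesis by blast
qed

text \<open>The solution operator of the Lyapunov equation \<open>SX + XS = Y\<close>, meaningful for positive definite \<open>S\<close>.\<close>

definition lyap :: "'n::finite cmat \<Rightarrow> 'n cmat \<Rightarrow> 'n cmat" where
  "lyap S = inv_into UNIV (\<lambda>X. S ** X + X ** S)"

lemma lyap_solution:
  assumes S: "psd S" "invertible (S :: 'n::finite cmat)"
  shows "S ** lyap S Y + lyap S Y ** S = Y"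
    and "S ** X + X ** S = Y \<Longrightarrow> lyap S Y = X"
    and "bounded_linear (lyap S)"
proof -
  define L where "L = (\<lambda>X :: 'n cmat. S ** X + X ** S)"
  have lin: "linear L"
    unfolding L_def by (intro bounded_linear.linear bounded_linear_add bounded_linear_mult_left bounded_linear_mult_right)
  have inj: "inj L"
  proof -
    obtain m where m: "m > 0" "\<And>(X :: 'n cmat) S'. psd S' \<Longrightarrow> m * norm X \<le> norm (S ** X + X ** S')"
      using sylvester_lower_bound[OF S] by blast
    have "X = 0" if "L X = 0" for X
    proof -
      have "m * norm X \<le> 0" using m(2)[OF S(1), of X] that by (simp add: L_def)
      then show ?thesis using m(1) by (simp add: mult_le_0_iff)
    qed
    then show ?thesis using linear_injective_0[OF lin] by blast
  qed
  then have surj: "surj L" using lin linear_injective_imp_surjective by blast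
  have G: "lyap S = inv_into UNIV L" by (simp add: lyap_def L_def)
  show 1: "S ** lyap S Y + lyap S Y ** S = Y" for Y
    using surj_f_inv_f[OF surj, of Y] unfolding G by (simp add: L_def)
  show 2: "S ** X + X ** S = Y \<Longrightarrow> lyap S Y = X" for X Y
    using inv_f_f[OF inj, of X] unfolding G by (simp add: L_def)
  show "bounded_linear (lyap S)"
    unfolding linear_conv_bounded_linear[symmetric]
  proof (rule linearI; rule 2)
    fix Y Z :: "'n cmat" and r :: real
    have "S ** (lyap S Y + lyap S Z) + (lyap S Y + lyap S Z) ** S =
        (S ** lyap S Y + lyap S Y ** S) + (S ** lyap S Z + lyap S Z ** S)"
      by (simp add: matrix_add_ldistrib matrix_add_rdistrib add_ac)
    then show "S ** (lyap S Y + lyap S Z) + (lyap S Y + lyap S Z) ** S = Y + Z" by (simp only: 1)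
    have "S ** (r *\<^sub>R lyap S Y) + (r *\<^sub>R lyap S Y) ** S = r *\<^sub>R (S ** lyap S Y + lyap S Y ** S)"
      by (simp add: matrix_mult_scaleR scaleR_matrix_mult scaleR_add_right)
    then show "S ** (r *\<^sub>R lyap S Y) + (r *\<^sub>R lyap S Y) ** S = r *\<^sub>R Y" by (simp only: 1)
  qed
qed

text \<open>Both differentiability proofs below have remainders of this kind: a product of a differentiable function that
  vanishes at \<open>p\<close>, hence is \<open>O(|q - p|)\<close>, with a factor that tends to zero.\<close>

lemma has_derivative_zero_product:
  assumes h: "(h has_derivative h') (at p)" "h p = 0" and k: "(k \<longlongrightarrow> (0::real)) (at p)"
    and E: "E p = 0" "eventually (\<lambda>q. norm (E q) \<le> norm (h q) * k q) (at p)"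
  shows "(E has_derivative (\<lambda>_. 0)) (at p)"
proof -
  obtain B where B: "\<And>x. norm (h' x) \<le> norm x * B" "B > 0"
    using bounded_linear.pos_bounded[OF has_derivative_bounded_linear[OF h(1)]] by blast
  define e where "e q = norm (h q - h p - h' (q - p)) / norm (q - p)" for q
  have e: "(e \<longlongrightarrow> 0) (at p)"
    using h(1) unfolding e_def has_derivative_iff_norm by simp
  have "((\<lambda>q. norm (E q - E p - 0) / norm (q - p)) \<longlongrightarrow> 0) (at p)"
  proof (rule tendsto_sandwich)
    show "\<forall>\<^sub>F q in at p. 0 \<le> norm (E q - E p - 0) / norm (q - p)" by simp
    show "((\<lambda>_. 0) \<longlongrightarrow> 0) (at p)" by simp
    have "((\<lambda>q. (e q + B) * \<bar>k q\<bar>) \<longlongrightarrow> (0 + B) * \<bar>0\<bar>) (at p)"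
      by (intro tendsto_intros e k)
    then show "((\<lambda>q. (e q + B) * \<bar>k q\<bar>) \<longlongrightarrow> 0) (at p)" by simp
    have ne: "\<forall>\<^sub>F q in at p. q \<noteq> p" by (simp add: eventually_at_filter)
    show "\<forall>\<^sub>F q in at p. norm (E q - E p - 0) / norm (q - p) \<le> (e q + B) * \<bar>k q\<bar>"
      using E(2) ne
    proof eventually_elim
      case (elim q)
      have "norm (h q) \<le> norm (h q - h p - h' (q - p)) + norm (h' (q - p))"
        using norm_triangle_ineq[of "h q - h p - h' (q - p)" "h' (q - p)"] by (simp add: h)
      also have "\<dots> \<le> e q * norm (q - p) + norm (q - p) * B"
        using B(1)[of "q - p"] elim(2) by (simp add: e_def)
      finally have "norm (h q) \<le> (e q + B) * norm (q - p)" by (simp add: algebra_simps)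
      moreover have "norm (E q) \<le> norm (h q) * \<bar>k q\<bar>"
        using elim(1) by (smt (verit) mult_left_mono norm_ge_zero)
      ultimately have "norm (E q) \<le> ((e q + B) * norm (q - p)) * \<bar>k q\<bar>"
        by (smt (verit) mult_right_mono abs_ge_zero)
      then show ?case using elim(2) by (simp add: E(1) field_simps)
    qed
  qed
  then show ?thesis unfolding has_derivative_iff_norm by simp
qed

text \<open>With \<open>\<Delta> = R q - R p\<close>, the equation \<open>R p \<Delta> + \<Delta> R q = T q - T p\<close> and the uniform coercivity make \<open>R\<close>
  Lipschitz at \<open>p\<close>. The same equation in the form \<open>R p \<Delta> + \<Delta> R p = T q - T p - \<Delta>\<^sup>2\<close> then expresses \<open>\<Delta>\<close> by the
  solution operator at \<open>p\<close>, with a remainder of second order.\<close>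

lemma psd_sqrt_has_derivative:
  fixes T :: "'a::euclidean_space \<Rightarrow> 'n::finite cmat"
  assumes T: "(T has_derivative T') (at p)" "\<And>q. psd (T q)" "invertible (T p)"
  shows "((\<lambda>q. psd_sqrt (T q)) has_derivative (\<lambda>v. lyap (psd_sqrt (T p)) (T' v))) (at p)"
proof -
  define R where "R q = psd_sqrt (T q)" for q
  have R: "psd (R q)" "R q ** R q = T q" "invertible (R p)" for q
    unfolding R_def by (rule psd_sqrt(1)[OF T(2)], rule psd_sqrt(2)[OF T(2)], rule invertible_psd_sqrt[OF T(2,3)])
  obtain m where m: "m > 0" "\<And>(X :: 'n cmat) S'. psd S' \<Longrightarrow> m * norm X \<le> norm (R p ** X + X ** S')"
    using sylvester_lower_bound[OF R(1,3)] by blast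
  obtain C where C: "C > 0" "\<And>(X :: 'n cmat) (Y :: 'n cmat). norm (X ** Y) \<le> norm X * norm Y * C"
    using norm_matrix_mult_bound by blast
  have lip: "norm (R q - R p) \<le> norm (T q - T p) / m" for q
  proof -
    have "R p ** (R q - R p) + (R q - R p) ** R q = T q - T p"
      by (simp add: matrix_diff_ldistrib matrix_diff_rdistrib R(2))
    then have "m * norm (R q - R p) \<le> norm (T q - T p)" using m(2)[OF R(1), of "R q - R p" q] by simp
    then show ?thesis using m(1) by (simp add: field_simps)
  qed
  define E where "E q = (R q - R p) ** (R q - R p)" for q
  have E: "(E has_derivative (\<lambda>_. 0)) (at p)"
  proof (rule has_derivative_zero_product)
    show "((\<lambda>q. T q - T p) has_derivative T') (at p)"
      using has_derivative_diff[OF T(1) has_derivative_const[of "T p"]] by simp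
    have "isCont T p" using T(1) by (rule has_derivative_continuous)
    then have "((\<lambda>q. norm (T q - T p) * (C / m\<^sup>2)) \<longlongrightarrow> norm (T p - T p) * (C / m\<^sup>2)) (at p)"
      unfolding isCont_def by (intro tendsto_intros)
    then show "((\<lambda>q. norm (T q - T p) * (C / m\<^sup>2)) \<longlongrightarrow> 0) (at p)" by simp
    show "\<forall>\<^sub>F q in at p. norm (E q) \<le> norm (T q - T p) * (norm (T q - T p) * (C / m\<^sup>2))"
    proof (rule always_eventually, rule allI)
      fix q
      have "norm (E q) \<le> norm (R q - R p) * norm (R q - R p) * C" unfolding E_def by (rule C)
      also have "\<dots> \<le> (norm (T q - T p) / m) * (norm (T q - T p) / m) * C"
        using C(1) by (intro mult_mono lip) (auto simp: m(1) less_imp_le)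
      finally show "norm (E q) \<le> norm (T q - T p) * (norm (T q - T p) * (C / m\<^sup>2))"
        by (simp add: power2_eq_square mult_ac)
    qed
  qed (simp_all add: E_def)
  have G: "bounded_linear (lyap (R p))" by (rule lyap_solution(3)[OF R(1,3)])
  define F where "F q = R p + lyap (R p) (T q - T p - E q)" for q
  have F_eq: "F = R"
  proof
    fix q
    have "lyap (R p) (T q - T p - E q) = R q - R p"
      by (rule lyap_solution(2)[OF R(1,3)])
        (simp add: E_def matrix_diff_ldistrib matrix_diff_rdistrib R(2))
    then show "F q = R q" by (simp add: F_def)
  qed
  have "(F has_derivative (\<lambda>v. 0 + lyap (R p) (T' v - 0 - 0))) (at p)"
    unfolding F_def
    by (intro has_derivative_add has_derivative_const bounded_linear.has_derivative[OF G]
        has_derivative_diff T(1) E)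
  then have "(R has_derivative (\<lambda>v. lyap (R p) (T' v))) (at p)"
    by (simp add: F_eq)
  then show ?thesis by (simp add: R_def[abs_def])
qed

text \<open>Differentiating \<open>RX + XR = f\<close> formally gives \<open>R dX + dX R = df - dR X - X dR\<close>. To justify this, \<open>X q\<close> is first
  shown to be continuous at \<open>p\<close> and is then expressed by the solution operator at \<open>p\<close>.\<close>

lemma lyap_has_derivative:
  fixes R :: "'a::euclidean_space \<Rightarrow> 'n::finite cmat"
  assumes R: "(R has_derivative R') (at p)" and f: "(f has_derivative f') (at p)"
    and S: "open S" "p \<in> S" and psd: "\<And>q. psd (R q)" and inv: "\<And>q. q \<in> S \<Longrightarrow> invertible (R q)"
  defines "X \<equiv> \<lambda>q. lyap (R q) (f q)"
  shows "(X has_derivative (\<lambda>v. lyap (R p) (f' v - R' v ** X p - X p ** R' v))) (at p)"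
proof -
  have X: "R q ** X q + X q ** R q = f q" if "q \<in> S" for q
    unfolding X_def by (rule lyap_solution(1)[OF psd inv[OF that]])
  have G: "bounded_linear (lyap (R p))" by (rule lyap_solution(3)[OF psd inv[OF S(2)]])
  obtain m where m: "m > 0" "\<And>(X :: 'n cmat) S'. psd S' \<Longrightarrow> m * norm X \<le> norm (R p ** X + X ** S')"
    using sylvester_lower_bound[OF psd inv[OF S(2)]] by blast
  obtain C where C: "C > 0" "\<And>(X :: 'n cmat) (Y :: 'n cmat). norm (X ** Y) \<le> norm X * norm Y * C"
    using norm_matrix_mult_bound by blast
  have diff: "R p ** (X q - X p) + (X q - X p) ** R p = f q - f p - (R q - R p) ** X q - X q ** (R q - R p)"
    if "q \<in> S" for q
    using X[OF that] X[OF S(2)] by (simp add: matrix_diff_ldistrib matrix_diff_rdistrib algebra_simps)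
  have ev: "\<forall>\<^sub>F q in at p. q \<in> S" using S by (rule eventually_at_in_open')
  have "isCont R p" using R by (rule has_derivative_continuous)
  then have d: "((\<lambda>q. norm (R q - R p)) \<longlongrightarrow> 0) (at p)"
    unfolding isCont_def by (simp add: tendsto_norm_zero LIM_zero)
  have "isCont f p" using f by (rule has_derivative_continuous)
  then have fd: "((\<lambda>q. norm (f q - f p)) \<longlongrightarrow> 0) (at p)"
    unfolding isCont_def by (simp add: tendsto_norm_zero LIM_zero)
  \<comment> \<open>Below, \<open>\<delta> < m/(4C)\<close> allows the term \<open>2C\<delta> |X q - X p|\<close> to be absorbed in \<open>m |X q - X p|\<close>.\<close>
  have small: "\<forall>\<^sub>F q in at p. norm (R q - R p) < m / (4 * C)"
    using order_tendstoD(2)[OF d, of "m / (4 * C)"] m(1) C(1) by simp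
  have Xd: "((\<lambda>q. norm (X q - X p)) \<longlongrightarrow> 0) (at p)"
  proof (rule tendsto_sandwich)
    show "\<forall>\<^sub>F q in at p. 0 \<le> norm (X q - X p)" by simp
    show "((\<lambda>_. 0) \<longlongrightarrow> 0) (at p)" by simp
    have "((\<lambda>q. (norm (f q - f p) + 2 * C * norm (R q - R p) * norm (X p)) * (2 / m)) \<longlongrightarrow>
        (0 + 2 * C * 0 * norm (X p)) * (2 / m)) (at p)"
      by (intro tendsto_intros fd d)
    then show "((\<lambda>q. (norm (f q - f p) + 2 * C * norm (R q - R p) * norm (X p)) * (2 / m)) \<longlongrightarrow> 0) (at p)" by simp
    show "\<forall>\<^sub>F q in at p. norm (X q - X p) \<le>
        (norm (f q - f p) + 2 * C * norm (R q - R p) * norm (X p)) * (2 / m)"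
      using ev small
    proof eventually_elim
      case (elim q)
      define \<delta> where "\<delta> = norm (R q - R p)"
      have "m * norm (X q - X p) \<le> norm (f q - f p - (R q - R p) ** X q - X q ** (R q - R p))"
        using m(2)[OF psd, of "X q - X p" p] diff[OF elim(1)] by simp
      also have "\<dots> \<le> norm (f q - f p) + norm ((R q - R p) ** X q) + norm (X q ** (R q - R p))"
        by (smt (verit) norm_triangle_ineq4)
      also have "\<dots> \<le> norm (f q - f p) + 2 * C * \<delta> * norm (X q)"
        using C(2)[of "R q - R p" "X q"] C(2)[of "X q" "R q - R p"] by (simp add: \<delta>_def mult_ac)
      also have "\<dots> \<le> norm (f q - f p) + 2 * C * \<delta> * (norm (X p) + norm (X q - X p))"
        using norm_triangle_ineq[of "X p" "X q - X p"] C(1) by (intro add_left_mono mult_left_mono) (simp_all add: \<delta>_def)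
      also have "\<dots> \<le> norm (f q - f p) + 2 * C * \<delta> * norm (X p) + (m / 2) * norm (X q - X p)"
      proof -
        have "2 * C * \<delta> \<le> m / 2" using elim(2) C(1) by (simp add: \<delta>_def field_simps)
        then have "2 * C * \<delta> * norm (X q - X p) \<le> (m / 2) * norm (X q - X p)" by (rule mult_right_mono) simp
        then show ?thesis by (simp add: distrib_left)
      qed
      finally have "(m / 2) * norm (X q - X p) \<le> norm (f q - f p) + 2 * C * \<delta> * norm (X p)"
        by (simp add: field_simps)
      then show ?case using m(1) by (simp add: \<delta>_def field_simps)
    qed
  qed
  have h: "((\<lambda>q. R q - R p) has_derivative R') (at p)"
    using has_derivative_diff[OF R has_derivative_const[of "R p"]] by simp
  have k: "((\<lambda>q. norm (X q - X p) * C) \<longlongrightarrow> 0) (at p)"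
    using tendsto_mult[OF Xd tendsto_const[of C]] by simp
  have E1: "((\<lambda>q. (R q - R p) ** (X q - X p)) has_derivative (\<lambda>_. 0)) (at p)"
    by (rule has_derivative_zero_product[OF h _ k])
      (auto intro!: always_eventually order_trans[OF C(2)] simp: mult.assoc)
  have E2: "((\<lambda>q. (X q - X p) ** (R q - R p)) has_derivative (\<lambda>_. 0)) (at p)"
    by (rule has_derivative_zero_product[OF h _ k])
      (auto intro!: always_eventually order_trans[OF C(2)] simp: mult_ac)
  have P1: "((\<lambda>q. (R q - R p) ** X p) has_derivative (\<lambda>v. R' v ** X p)) (at p)"
    by (rule bounded_linear.has_derivative[OF bounded_linear_mult_right h])
  have P2: "((\<lambda>q. X p ** (R q - R p)) has_derivative (\<lambda>v. X p ** R' v)) (at p)"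
    by (rule bounded_linear.has_derivative[OF bounded_linear_mult_left h])
  define F where "F q = X p + lyap (R p) (f q - f p - ((R q - R p) ** X p + (R q - R p) ** (X q - X p))
      - (X p ** (R q - R p) + (X q - X p) ** (R q - R p)))" for q
  have "(F has_derivative (\<lambda>v. 0 + lyap (R p) (f' v - 0 - (R' v ** X p + 0) - (X p ** R' v + 0)))) (at p)"
    unfolding F_def
    by (intro has_derivative_add has_derivative_const bounded_linear.has_derivative[OF G]
        has_derivative_diff f P1 P2 E1 E2)
  then have "(F has_derivative (\<lambda>v. lyap (R p) (f' v - R' v ** X p - X p ** R' v))) (at p)" by simp
  moreover have "F q = X q" if "q \<in> S" for q
  proof -
    have "lyap (R p) (f q - f p - (R q - R p) ** X q - X q ** (R q - R p)) = X q - X p"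
      by (rule lyap_solution(2)[OF psd inv[OF S(2)]]) (rule diff[OF that])
    moreover have "(R q - R p) ** X p + (R q - R p) ** (X q - X p) = (R q - R p) ** X q"
      "X p ** (R q - R p) + (X q - X p) ** (R q - R p) = X q ** (R q - R p)"
      by (simp_all flip: matrix_add_ldistrib matrix_add_rdistrib)
    ultimately show ?thesis by (simp add: F_def)
  qed
  ultimately show ?thesis by (rule has_derivative_transform_within_open[OF _ S])
qed

section \<open>Smooth families of matrices\<close>

text \<open>The derivative at a point of an open set depends only on the germ of the function.\<close>

lemma Ck_on_cong:
  assumes S: "open S" and eq: "\<And>x. x \<in> S \<Longrightarrow> f x = g x" and f: "Ck_on k S f"
  shows "Ck_on k S g"
  using eq f
proof (induction k arbitrary: f g)
  case 0
  then show ?case using continuous_on_cong[of S S f g] by simp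
next
  case (Suc k)
  have g: "(g has_derivative frechet_derivative f (at x)) (at x)" if x: "x \<in> S" for x
  proof (rule has_derivative_transform_within_open[OF _ S x])
    show "(f has_derivative frechet_derivative f (at x)) (at x)"
      using Suc.prems(2) x frechet_derivative_works by auto
  qed (use Suc.prems(1) in auto)
  have "Ck_on k S (\<lambda>x. frechet_derivative g (at x) v)" for v
  proof (rule Suc.IH)
    show "Ck_on k S (\<lambda>x. frechet_derivative f (at x) v)" using Suc.prems(2) by simp
    show "frechet_derivative f (at x) v = frechet_derivative g (at x) v" if "x \<in> S" for x
      using frechet_derivative_at[OF g[OF that]] by simp
  qed
  then show ?case using g by (auto simp: differentiable_def)
qed

lemma Ck_on_SucI:
  assumes S: "open S" and f': "\<And>x. x \<in> S \<Longrightarrow> (f has_derivative f' x) (at x)"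
    and C: "\<And>v. Ck_on k S (\<lambda>x. f' x v)"
  shows "Ck_on (Suc k) S f"
proof -
  have "Ck_on k S (\<lambda>x. frechet_derivative f (at x) v)" for v
  proof (rule Ck_on_cong[OF S _ C])
    show "f' x v = frechet_derivative f (at x) v" if "x \<in> S" for x
      using frechet_derivative_at[OF f'[OF that]] by simp
  qed
  then show ?thesis using f' by (auto simp: differentiable_def)
qed

lemma Ck_on_has_derivative:
  assumes "Ck_on (Suc k) S f" "x \<in> S"
  shows "(f has_derivative frechet_derivative f (at x)) (at x)"
  using assms frechet_derivative_works by auto

lemma Ck_on_Pair:
  assumes S: "open S" and f: "Ck_on k S f" and g: "Ck_on k S g"
  shows "Ck_on k S (\<lambda>x. (f x, g x))"
  using f g
proof (induction k arbitrary: f g)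
  case 0
  then show ?case by (simp add: continuous_on_Pair)
next
  case (Suc k)
  show ?case
  proof (rule Ck_on_SucI[OF S])
    show "((\<lambda>x. (f x, g x)) has_derivative
        (\<lambda>v. (frechet_derivative f (at x) v, frechet_derivative g (at x) v))) (at x)" if "x \<in> S" for x
      using that Suc.prems by (intro has_derivative_Pair Ck_on_has_derivative)
    show "Ck_on k S (\<lambda>x. (frechet_derivative f (at x) v, frechet_derivative g (at x) v))" for v
      using Suc.prems by (intro Suc.IH) simp_all
  qed
qed

text \<open>A family of functions that is closed under directional derivatives consists of smooth functions. Applied to
  suitable inductive families, this replaces rules for composition and for higher derivatives of products.\<close>

lemma Ck_on_closed_family:
  assumes S: "open S"
    and F: "\<And>f. F f \<Longrightarrow> \<exists>f'. (\<forall>x\<in>S. (f has_derivative f' x) (at x)) \<and> (\<forall>v. F (\<lambda>x. f' x v))"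
    and f: "F f"
  shows "Ck_on k S f"
  using f
proof (induction k arbitrary: f)
  case 0
  then obtain f' where "\<forall>x\<in>S. (f has_derivative f' x) (at x)" using F by blast
  then have "continuous_on S f"
    by (intro has_derivative_continuous_on[where f' = f']) (blast intro: has_derivative_at_withinI)
  then show ?case by simp
next
  case (Suc k)
  then obtain f' where "\<forall>x\<in>S. (f has_derivative f' x) (at x)" "\<forall>v. F (\<lambda>x. f' x v)" using F by blast
  then show ?case using Suc.IH by (intro Ck_on_SucI[OF S, of _ f']) auto
qed

text \<open>These are polynomials in the real coordinates. Real linear maps are among the generators, so that adjoints and complex
  conjugates are included.\<close>

inductive poly_map :: "('a::euclidean_space \<Rightarrow> 'n::finite cmat) \<Rightarrow> bool" where
  linear: "bounded_linear L \<Longrightarrow> poly_map L"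
| const: "poly_map (\<lambda>_. C)"
| add: "poly_map f \<Longrightarrow> poly_map g \<Longrightarrow> poly_map (\<lambda>p. f p + g p)"
| mult: "poly_map f \<Longrightarrow> poly_map g \<Longrightarrow> poly_map (\<lambda>p. f p ** g p)"

lemmas matrix_mult_has_derivative = bounded_bilinear.FDERIV[OF bounded_bilinear_matrix_mult]

lemma poly_map_has_derivative:
  "poly_map f \<Longrightarrow> \<exists>f'. (\<forall>p. (f has_derivative f' p) (at p)) \<and> (\<forall>v. poly_map (\<lambda>p. f' p v))"
proof (induction rule: poly_map.induct)
  case (linear L)
  then show ?case
    by (intro exI[of _ "\<lambda>_. L"]) (auto intro: bounded_linear_imp_has_derivative poly_map.const)
next
  case (const C)
  then show ?case by (intro exI[of _ "\<lambda>_ _. 0"]) (auto intro: poly_map.const)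
next
  case (add f g)
  then obtain f' g' where "\<And>p. (f has_derivative f' p) (at p)" "\<And>v. poly_map (\<lambda>p. f' p v)"
    "\<And>p. (g has_derivative g' p) (at p)" "\<And>v. poly_map (\<lambda>p. g' p v)" by blast
  then show ?case
    by (intro exI[of _ "\<lambda>p v. f' p v + g' p v"]) (auto intro: has_derivative_add poly_map.add)
next
  case (mult f g)
  then obtain f' g' where "\<And>p. (f has_derivative f' p) (at p)" "\<And>v. poly_map (\<lambda>p. f' p v)"
    "\<And>p. (g has_derivative g' p) (at p)" "\<And>v. poly_map (\<lambda>p. g' p v)" by blast
  note * = this
  show ?case
  proof (intro exI conjI allI)
    show "((\<lambda>p. f p ** g p) has_derivative (\<lambda>v. f p ** g' p v + f' p v ** g p)) (at p)" for p
      by (rule matrix_mult_has_derivative[OF *(1,3)])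
    show "poly_map (\<lambda>p. f p ** g' p v + f' p v ** g p)" for v
      by (intro poly_map.add poly_map.mult mult.hyps *)
  qed
qed

lemma poly_map_cadj: "poly_map f \<Longrightarrow> poly_map (\<lambda>p. cadj (f p))"
proof (induction rule: poly_map.induct)
  case (linear L)
  then show ?case
    by (intro poly_map.linear bounded_linear_compose[OF bounded_linear_cadj])
qed (auto intro: poly_map.intros)

lemma poly_map_continuous: "poly_map f \<Longrightarrow> continuous_on A f"
  by (meson has_derivative_at_withinI has_derivative_continuous_on poly_map_has_derivative)

lemma poly_map_Ck_on: "poly_map f \<Longrightarrow> Ck_on k UNIV f"
  using Ck_on_closed_family[of UNIV poly_map f k] poly_map_has_derivative by auto

text \<open>The closure of the polynomials, the root of a fixed \<open>T\<close> and the solution operator at this root under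
  sums, differences and products. It is chosen as the smallest family that contains the root and its derivatives of all
  orders.\<close>

inductive root_map :: "('a::euclidean_space \<Rightarrow> 'n::finite cmat) \<Rightarrow> ('a \<Rightarrow> 'n cmat) \<Rightarrow> bool"
  for T where
  poly: "poly_map f \<Longrightarrow> root_map T f"
| root: "root_map T (\<lambda>p. psd_sqrt (T p))"
| lyap: "root_map T f \<Longrightarrow> root_map T (\<lambda>p. lyap (psd_sqrt (T p)) (f p))"
| add: "root_map T f \<Longrightarrow> root_map T g \<Longrightarrow> root_map T (\<lambda>p. f p + g p)"
| diff: "root_map T f \<Longrightarrow> root_map T g \<Longrightarrow> root_map T (\<lambda>p. f p - g p)"
| mult: "root_map T f \<Longrightarrow> root_map T g \<Longrightarrow> root_map T (\<lambda>p. f p ** g p)"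

lemma root_map_has_derivative:
  assumes T: "poly_map T" "\<And>p. psd (T p)" and S: "open S" "\<And>p. p \<in> S \<Longrightarrow> invertible (T p)"
    and f: "root_map T f"
  shows "\<exists>f'. (\<forall>p\<in>S. (f has_derivative f' p) (at p)) \<and> (\<forall>v. root_map T (\<lambda>p. f' p v))"
proof -
  obtain T' where T': "\<And>p. (T has_derivative T' p) (at p)" "\<And>v. poly_map (\<lambda>p. T' p v)"
    using poly_map_has_derivative[OF T(1)] by blast
  define R where "R p = psd_sqrt (T p)" for p
  define R' where "R' p v = lyap (R p) (T' p v)" for p v
  have R: "psd (R p)" "p \<in> S \<Longrightarrow> invertible (R p)" for p
    using T(2) S(2) by (simp_all add: R_def psd_sqrt invertible_psd_sqrt)
  have dR: "(R has_derivative R' p) (at p)" if "p \<in> S" for p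
    unfolding R_def[abs_def] R'_def by (rule psd_sqrt_has_derivative[OF T'(1) T(2) S(2)[OF that]])
  have rR: "root_map T R" "root_map T (\<lambda>p. R' p v)" for v
    unfolding R_def[abs_def] R'_def[abs_def] by (intro root_map.intros(1-3) T')+
  show ?thesis using f
  proof (induction rule: root_map.induct)
    case (poly f)
    then show ?case using poly_map_has_derivative[of f] by (meson root_map.poly)
  next
    case root
    show ?case using dR rR(2) unfolding R_def[abs_def] by blast
  next
    case (lyap f)
    then obtain f' where f': "\<And>p. p \<in> S \<Longrightarrow> (f has_derivative f' p) (at p)" "\<And>v. root_map T (\<lambda>p. f' p v)"
      by blast
    define X where "X p = lyap (R p) (f p)" for p
    have X: "root_map T X" unfolding X_def[abs_def] R_def by (rule root_map.lyap[OF lyap.hyps])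
    have "(X has_derivative (\<lambda>v. lyap (R p) (f' p v - R' p v ** X p - X p ** R' p v))) (at p)" if "p \<in> S" for p
      unfolding X_def[abs_def] by (rule lyap_has_derivative[OF dR[OF that] f'(1)[OF that] S(1) that R])
    moreover have "root_map T (\<lambda>p. lyap (R p) (f' p v - R' p v ** X p - X p ** R' p v))" for v
      unfolding R_def by (intro root_map.intros(3-6) f' rR X)
    ultimately show ?case unfolding X_def[abs_def] R_def
      by (intro exI[of _ "\<lambda>p v. lyap (psd_sqrt (T p)) (f' p v - R' p v ** lyap (psd_sqrt (T p)) (f p) -
        lyap (psd_sqrt (T p)) (f p) ** R' p v)"]) blast
  next
    case (add f g)
    then obtain f' g' where "\<And>p. p \<in> S \<Longrightarrow> (f has_derivative f' p) (at p)" "\<And>v. root_map T (\<lambda>p. f' p v)"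
      "\<And>p. p \<in> S \<Longrightarrow> (g has_derivative g' p) (at p)" "\<And>v. root_map T (\<lambda>p. g' p v)" by blast
    then show ?case
      by (intro exI[of _ "\<lambda>p v. f' p v + g' p v"]) (auto intro: has_derivative_add root_map.add)
  next
    case (diff f g)
    then obtain f' g' where "\<And>p. p \<in> S \<Longrightarrow> (f has_derivative f' p) (at p)" "\<And>v. root_map T (\<lambda>p. f' p v)"
      "\<And>p. p \<in> S \<Longrightarrow> (g has_derivative g' p) (at p)" "\<And>v. root_map T (\<lambda>p. g' p v)" by blast
    then show ?case
      by (intro exI[of _ "\<lambda>p v. f' p v - g' p v"]) (auto intro: has_derivative_diff root_map.diff)
  next
    case (mult f g)
    then obtain f' g' where "\<And>p. p \<in> S \<Longrightarrow> (f has_derivative f' p) (at p)" "\<And>v. root_map T (\<lambda>p. f' p v)"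
      "\<And>p. p \<in> S \<Longrightarrow> (g has_derivative g' p) (at p)" "\<And>v. root_map T (\<lambda>p. g' p v)" by blast
    note * = this
    show ?case
    proof (intro exI conjI allI ballI)
      show "((\<lambda>p. f p ** g p) has_derivative (\<lambda>v. f p ** g' p v + f' p v ** g p)) (at p)" if "p \<in> S" for p
        by (rule matrix_mult_has_derivative[OF *(1)[OF that] *(3)[OF that]])
      show "root_map T (\<lambda>p. f p ** g' p v + f' p v ** g p)" for v
        by (intro root_map.add root_map.mult mult.hyps *)
    qed
  qed
qed

lemma open_invertible:
  assumes "continuous_on UNIV (T :: 'a::euclidean_space \<Rightarrow> 'n::finite cmat)"
  shows "open {p. invertible (T p)}"
proof -
  have "continuous_on UNIV (\<lambda>p. det (T p))"
    unfolding det_def by (intro continuous_intros assms)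
  then have "open {p. det (T p) \<noteq> 0}"
    by (intro open_Collect_neq continuous_on_const)
  then show ?thesis by (simp add: invertible_det_nz)
qed

text \<open>The inverse of \<open>R = T\<^sup>1\<^sup>/\<^sup>2\<close> is the solution of \<open>RX + XR = 2\<close>, so the components belong to the family of
  \<open>root_map\<close>. Both the action and the inversion of the group have this shape.\<close>

lemma smooth_normalised_pair:
  assumes M: "poly_map M1" "poly_map M2" and T: "poly_map T" "\<And>p. psd (T p)"
  shows "smooth_open {p. invertible (T p)}
    (\<lambda>p. (M1 p ** matrix_inv (psd_sqrt (T p)), M2 p ** matrix_inv (psd_sqrt (T p))))"
  unfolding smooth_open_def
proof (intro conjI allI)
  define S where "S = {p. invertible (T p)}"
  show S: "open {p. invertible (T p)}" using poly_map_continuous[OF T(1)] by (rule open_invertible)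
  have C: "Ck_on k S (\<lambda>p. M p ** matrix_inv (psd_sqrt (T p)))" if "poly_map M" for M k
  proof (rule Ck_on_cong)
    show "open S" using S by (simp add: S_def)
    show "Ck_on k S (\<lambda>p. M p ** lyap (psd_sqrt (T p)) (mat 2))"
    proof (rule Ck_on_closed_family[where F = "root_map T"])
      show "open S" by fact
      show "root_map T (\<lambda>p. M p ** lyap (psd_sqrt (T p)) (mat 2))"
        using that by (intro root_map.intros(1,3,6) poly_map.const)
      show "\<exists>f'. (\<forall>x\<in>S. (f has_derivative f' x) (at x)) \<and> (\<forall>v. root_map T (\<lambda>x. f' x v))" if "root_map T f" for f
        using T \<open>open S\<close> _ that by (rule root_map_has_derivative) (simp add: S_def)
    qed
    fix p assume "p \<in> S"
    then have inv: "invertible (psd_sqrt (T p))" using T(2) by (simp add: S_def invertible_psd_sqrt)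
    have "lyap (psd_sqrt (T p)) (mat 2) = matrix_inv (psd_sqrt (T p))"
      by (rule lyap_solution(2)[OF psd_sqrt(1)[OF T(2)] inv]) (simp add: invertible_matrix_inv[OF inv] mat_add)
    then show "M p ** lyap (psd_sqrt (T p)) (mat 2) = M p ** matrix_inv (psd_sqrt (T p))" by simp
  qed
  show "Ck_on k {p. invertible (T p)}
      (\<lambda>p. (M1 p ** matrix_inv (psd_sqrt (T p)), M2 p ** matrix_inv (psd_sqrt (T p))))" for k
    using C[OF M(1), of k] C[OF M(2), of k] S unfolding S_def by (intro Ck_on_Pair)
qed

section \<open>Submanifolds and smooth maps\<close>

lemma smooth_map_of_smooth_open:
  assumes "smooth_open U g" "S \<subseteq> U" "\<And>x. x \<in> S \<Longrightarrow> g x = f x"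
  shows "smooth_map S f"
  unfolding smooth_map_def
proof
  fix p assume "p \<in> S"
  then show "\<exists>U g. p \<in> U \<and> smooth_open U g \<and> (\<forall>x\<in>S \<inter> U. g x = f x)"
    using assms by (intro exI[of _ U] exI[of _ g]) auto
qed

lemma smooth_map_cong:
  assumes "\<And>x. x \<in> S \<Longrightarrow> f x = g x" "smooth_map S f" shows "smooth_map S g"
proof -
  have "(\<forall>x\<in>S \<inter> U. h x = f x) = (\<forall>x\<in>S \<inter> U. h x = g x)" for U h
    using assms(1) by (intro ball_cong) auto
  with assms(2) show ?thesis unfolding smooth_map_def by (simp only:)
qed

lemma smooth_map_subset:
  assumes "smooth_map S f" "T \<subseteq> S" shows "smooth_map T f"
  unfolding smooth_map_def
proof
  fix p assume "p \<in> T"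
  then have "p \<in> S" using assms(2) by blast
  then obtain U g where "p \<in> U" "smooth_open U g" "\<forall>x\<in>S \<inter> U. g x = f x"
    using assms(1) unfolding smooth_map_def by blast
  then show "\<exists>U g. p \<in> U \<and> smooth_open U g \<and> (\<forall>x\<in>T \<inter> U. g x = f x)"
    using assms(2) by (intro exI[of _ U] exI[of _ g]) auto
qed

lemma smooth_open_subset:
  fixes f :: "'a::euclidean_space \<Rightarrow> 'b::euclidean_space"
  assumes "smooth_open U f" "open V" "V \<subseteq> U" shows "smooth_open V f"
proof -
  have "Ck_on k V f" if "Ck_on k U f" for k and f :: "'a \<Rightarrow> 'b"
    using that
  proof (induction k arbitrary: f)
    case 0
    then show ?case using assms(3) by (simp add: continuous_on_subset)
  next
    case (Suc k)
    have "Ck_on k V (\<lambda>x. frechet_derivative f (at x) v)" for v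
      using Suc.prems by (intro Suc.IH) simp
    then show ?case using Suc.prems assms(3) by auto
  qed
  then show ?thesis using assms(1,2) unfolding smooth_open_def by blast
qed

lemma embedded_submanifold_open_Int:
  assumes S: "embedded_submanifold k (S :: 'a::euclidean_space set)" and V: "open V"
  shows "embedded_submanifold k (S \<inter> V)"
  unfolding embedded_submanifold_def
proof
  fix p assume p: "p \<in> S \<inter> V"
  then have "p \<in> S" by simp
  from S[unfolded embedded_submanifold_def, rule_format, OF this]
  obtain U W and F :: "'a \<Rightarrow> 'a" where *: "p \<in> U" "subspace W" "dim W + k = DIM('a)"
    "smooth_open U F" "F ` U \<subseteq> W" "S \<inter> U = {x \<in> U. F x = 0}"
    "\<forall>x\<in>S \<inter> U. range (frechet_derivative F (at x)) = W"
    by (elim exE conjE)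
  show "\<exists>U W. \<exists>F :: 'a \<Rightarrow> 'a. p \<in> U \<and> subspace W \<and> dim W + k = DIM('a) \<and> smooth_open U F \<and> F ` U \<subseteq> W \<and>
      S \<inter> V \<inter> U = {x \<in> U. F x = 0} \<and> (\<forall>x\<in>S \<inter> V \<inter> U. range (frechet_derivative F (at x)) = W)"
  proof (intro exI conjI)
    show "p \<in> U \<inter> V" using * p by simp
    show "smooth_open (U \<inter> V) F"
      using *(4) V by (intro smooth_open_subset[OF *(4)]) (auto simp: smooth_open_def)
    show "S \<inter> V \<inter> (U \<inter> V) = {x \<in> U \<inter> V. F x = 0}" using *(6) by blast
    show "F ` (U \<inter> V) \<subseteq> W" using *(5) by blast
    show "\<forall>x\<in>S \<inter> V \<inter> (U \<inter> V). range (frechet_derivative F (at x)) = W" using *(7) by simp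
  qed (fact *)+
qed

text \<open>The defining function is \<open>(A, B) \<mapsto> A\<^sup>*A + B\<^sup>*B - 1\<close>, with values in the Hermitian matrices.
  At a P-module it is a submersion: the direction \<open>(AH/2, BH/2)\<close> is mapped to \<open>H\<close>.\<close>

lemma embedded_submanifold_P_modules: "\<exists>k. embedded_submanifold k (P_modules :: 'n::finite pmod set)"
proof -
  define W :: "'n pmod set" where "W = {(H, K). cadj H = H \<and> K = 0}"
  define f :: "'n pmod \<Rightarrow> 'n cmat" where
    "f = (\<lambda>x. (cadj (fst x) ** fst x + cadj (snd x) ** snd x) + (- mat 1))"
  define f' :: "'n pmod \<Rightarrow> 'n pmod \<Rightarrow> 'n cmat" where
    "f' x v = cadj (fst x) ** fst v + cadj (fst v) ** fst x + (cadj (snd x) ** snd v + cadj (snd v) ** snd x)" for x v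
  have W: "subspace W"
    unfolding W_def by (auto simp: subspace_def zero_prod_def)
  have "dim W \<le> DIM('n pmod)" by (rule dim_subset_UNIV)
  then obtain k where k: "dim W + k = DIM('n pmod)" using le_Suc_ex by metis
  have poly: "poly_map f"
    unfolding f_def by (intro poly_map.add poly_map.mult poly_map.const poly_map_cadj poly_map.linear
      bounded_linear_fst bounded_linear_snd)
  have "((\<lambda>x. f x) has_derivative (\<lambda>v. f' x v + 0)) (at x)" for x
    unfolding f_def f'_def
    by (intro has_derivative_add has_derivative_const matrix_mult_has_derivative
        bounded_linear.has_derivative[OF bounded_linear_cadj] has_derivative_fst has_derivative_snd
        has_derivative_ident)
  then have df: "((\<lambda>x. (f x, 0 :: 'n cmat)) has_derivative (\<lambda>v. (f' x v, 0))) (at x)" for x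
    by (intro has_derivative_Pair has_derivative_const) simp
  have smooth: "smooth_open UNIV (\<lambda>x. (f x, 0 :: 'n cmat))"
    unfolding smooth_open_def by (intro conjI allI open_UNIV Ck_on_Pair poly_map_Ck_on poly poly_map.const)
  have zero: "P_modules \<inter> UNIV = {x \<in> UNIV. (f x, 0 :: 'n cmat) = 0}"
    by (auto simp: P_modules_def f_def zero_prod_def)
  have mat1: "cadj (- mat 1 :: 'n cmat) = - mat 1"
    using cadj_simps(3)[of "0 :: 'n cmat" "mat 1"] by simp
  have range: "range (frechet_derivative (\<lambda>x. (f x, 0 :: 'n cmat)) (at x)) = W" if x: "x \<in> P_modules" for x
    unfolding frechet_derivative_at[OF df, symmetric]
  proof
    show "range (\<lambda>v. (f' x v, 0)) \<subseteq> W" by (auto simp: W_def f'_def add_ac)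
    show "W \<subseteq> range (\<lambda>v. (f' x v, 0))"
    proof
      fix w assume "w \<in> W"
      then obtain H where H: "w = (H, 0)" "cadj H = H" by (auto simp: W_def)
      obtain A B where AB: "x = (A, B)" "cadj A ** A + cadj B ** B = mat 1"
        using x by (auto simp: P_modules_def)
      have half: "(1/2) *\<^sub>R Y + (1/2) *\<^sub>R Y = Y" for Y :: "'n cmat" by (simp flip: scaleR_add_left)
      have "f' x ((1/2) *\<^sub>R (A ** H), (1/2) *\<^sub>R (B ** H)) =
          (1/2) *\<^sub>R ((cadj A ** A + cadj B ** B) ** H) + (1/2) *\<^sub>R (H ** (cadj A ** A + cadj B ** B))"
        by (simp add: f'_def AB(1) matrix_mult_scaleR scaleR_matrix_mult H matrix_mul_assoc
          matrix_add_ldistrib matrix_add_rdistrib scaleR_add_right add_ac)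
      also have "\<dots> = H" by (simp add: AB half)
      finally show "w \<in> range (\<lambda>v. (f' x v, 0))" using H by (metis rangeI)
    qed
  qed
  have into: "(\<lambda>x. (f x, 0)) ` UNIV \<subseteq> W" by (auto simp: W_def f_def mat1 add_ac)
  have "embedded_submanifold k (P_modules :: 'n pmod set)"
    unfolding embedded_submanifold_def
  proof (intro ballI exI conjI)
    fix p :: "'n pmod"
    show "p \<in> UNIV" by simp
    show "subspace W" "dim W + k = DIM('n pmod)" by (fact W k)+
    show "smooth_open UNIV (\<lambda>x. (f x, 0 :: 'n cmat))" by (fact smooth)
    show "(\<lambda>x. (f x, 0)) ` UNIV \<subseteq> W" by (fact into)
    show "P_modules \<inter> UNIV = {x \<in> UNIV. (f x, 0 :: 'n cmat) = 0}" by (fact zero)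
    show "range (frechet_derivative (\<lambda>x. (f x, 0 :: 'n cmat)) (at x)) = W" if "x \<in> P_modules \<inter> UNIV" for x
      using that by (intro range) simp
  qed
  then show ?thesis ..
qed

lemma bounded_linear_mat_entry: "bounded_linear (\<lambda>S :: 1 cmat. (mat (S $ 1 $ 1) :: 'n::finite cmat))"
  unfolding linear_conv_bounded_linear[symmetric]
  by (rule linearI) (simp_all add: vec_eq_iff mat_def)

text \<open>The matrix entry of a \<open>1 \<times> 1\<close> matrix extends the scalars \<open>a\<close> and \<open>b\<close> to the whole ambient space, so that a
  single formula extends the action to the open set where the operator under the root is invertible.\<close>

lemma smooth_unit_tensor:
  "smooth_map (carrier Irr_diff1 \<times> (P_modules :: 'n::finite pmod set)) (\<lambda>(g, X). unit_tensor g X)"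
proof (rule smooth_map_of_smooth_open)
  define M1 where "M1 p = (mat (fst (fst p) $ 1 $ 1) :: 'n cmat) ** fst (snd p)" for p :: "1 pmod \<times> 'n pmod"
  define M2 where "M2 p = (mat (snd (fst p) $ 1 $ 1) :: 'n cmat) ** snd (snd p)" for p :: "1 pmod \<times> 'n pmod"
  define T where "T p = cadj (M1 p) ** M1 p + cadj (M2 p) ** M2 p" for p :: "1 pmod \<times> 'n pmod"
  have M: "poly_map M1" "poly_map M2"
    unfolding M1_def[abs_def] M2_def[abs_def]
    by (intro poly_map.mult poly_map.linear bounded_linear_compose[OF bounded_linear_mat_entry]
        bounded_linear_fst_comp bounded_linear_snd_comp bounded_linear_fst bounded_linear_snd)+
  have T: "poly_map T" unfolding T_def[abs_def] by (intro poly_map.add poly_map.mult poly_map_cadj M)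
  have psd: "psd (T p)" for p unfolding T_def by (intro psd_add psd_cadj_mult)
  show "smooth_open {p. invertible (T p)}
      (\<lambda>p. (M1 p ** matrix_inv (psd_sqrt (T p)), M2 p ** matrix_inv (psd_sqrt (T p))))"
    by (rule smooth_normalised_pair[OF M T psd])
  have key: "invertible (T p) \<and> (M1 p ** matrix_inv (psd_sqrt (T p)), M2 p ** matrix_inv (psd_sqrt (T p))) =
      (case p of (g, X) \<Rightarrow> unit_tensor g X)" if p: "p \<in> carrier Irr_diff1 \<times> P_modules" for p
  proof -
    obtain g A B where p_eq: "p = (g, A, B)" by (metis surj_pair)
    have g: "g \<in> carrier Irr_diff1" and AB: "(A, B) \<in> P_modules" using p p_eq by auto
    obtain a b where g_eq: "g = (mat a, mat b)" and nz: "a \<noteq> 0" "b \<noteq> 0" using g by (rule carrier_IrrE)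
    have M: "M1 p = mat a ** A" "M2 p = mat b ** B" by (simp_all add: M1_def M2_def p_eq g_eq)
    have T: "T p = gram a b A B" unfolding T_def M gram_eq_cadj_mult ..
    show ?thesis
      unfolding T M unfolding p_eq g_eq using unit_tensor_eq[OF AB nz] invertible_gram[OF AB nz] by simp
  qed
  show "carrier Irr_diff1 \<times> P_modules \<subseteq> {p. invertible (T p)}" using key by blast
  show "\<And>p. p \<in> carrier Irr_diff1 \<times> P_modules \<Longrightarrow>
      (M1 p ** matrix_inv (psd_sqrt (T p)), M2 p ** matrix_inv (psd_sqrt (T p))) =
      (case p of (g, X) \<Rightarrow> unit_tensor g X)" using key by blast
qed

text \<open>Multiplied by \<open>|ab|\<^sup>2\<close>, the vector \<open>(1/a, 1/b)\<close> becomes the polynomial \<open>(cnj a |b|\<^sup>2, cnj b |a|\<^sup>2)\<close> of norm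
  \<open>|ab|\<close>; hence the inverse is the quotient of this polynomial by the root of \<open>|ab|\<^sup>2\<close>.\<close>

lemma smooth_Irr_inv: "smooth_map (carrier Irr_diff1) Irr_inv"
proof (rule smooth_map_of_smooth_open)
  define M1 where "M1 g = cadj (fst g) ** (cadj (snd g) ** snd g)" for g :: "1 pmod"
  define M2 where "M2 g = cadj (snd g) ** (cadj (fst g) ** fst g)" for g :: "1 pmod"
  define T where "T g = cadj (fst g ** snd g) ** (fst g ** snd g)" for g :: "1 pmod"
  have M: "poly_map M1" "poly_map M2"
    unfolding M1_def[abs_def] M2_def[abs_def]
    by (intro poly_map.mult poly_map_cadj poly_map.linear bounded_linear_fst bounded_linear_snd)+
  have T: "poly_map T" unfolding T_def[abs_def]
    by (intro poly_map.mult poly_map_cadj poly_map.linear bounded_linear_fst bounded_linear_snd)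
  have psd: "psd (T p)" for p unfolding T_def by (rule psd_cadj_mult)
  show "smooth_open {p. invertible (T p)}
      (\<lambda>p. (M1 p ** matrix_inv (psd_sqrt (T p)), M2 p ** matrix_inv (psd_sqrt (T p))))"
    by (rule smooth_normalised_pair[OF M T psd])
  have key: "invertible (T g) \<and> (M1 g ** matrix_inv (psd_sqrt (T g)), M2 g ** matrix_inv (psd_sqrt (T g))) = Irr_inv g"
    if g: "g \<in> carrier Irr_diff1" for g
  proof -
    obtain a b where g_eq: "g = (mat a, mat b)" and nz: "a \<noteq> 0" "b \<noteq> 0" using g by (rule carrier_IrrE)
    define r where "r = cmod a * cmod b"
    have r: "r > 0" using nz by (simp add: r_def)
    have T: "T g = mat (of_real (r * r))"
      unfolding T_def g_eq fst_conv snd_conv mat_mult_mat cadj_mat_of_real_mult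
      by (simp add: norm_mult power2_eq_square r_def)
    have K: "psd_sqrt (T g) = mat (of_real r)"
      using r by (intro psd_sqrt_eqI psd_mat) (simp_all add: T mat_mult_mat)
    have inv: "matrix_inv (mat (of_real r) :: 1 cmat) = mat (1 / of_real r)"
      using r by (simp add: matrix_inv_mat)
    have c: "cnj z = of_real ((cmod z)\<^sup>2) / z" if "z \<noteq> 0" for z
      using that complex_norm_square[of z] by (simp add: field_simps del: of_real_power)
    have "cnj a * of_real ((cmod b)\<^sup>2) * (1 / of_real r) = of_real r * (1 / a)"
      "cnj b * of_real ((cmod a)\<^sup>2) * (1 / of_real r) = of_real r * (1 / b)"
      using nz by (simp_all add: c r_def power2_eq_square field_simps)
    then have "(M1 g ** matrix_inv (psd_sqrt (T g)), M2 g ** matrix_inv (psd_sqrt (T g))) = Irr_inv g"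
      unfolding K inv unfolding M1_def M2_def g_eq fst_conv snd_conv cadj_mat_of_real_mult
      unfolding cadj_simps mat_mult_mat
      by (simp add: Irr_inv_def Let_def r_def)
    moreover have "invertible (T g)" unfolding T using r by (intro invertible_mat) simp
    ultimately show ?thesis by simp
  qed
  show "carrier Irr_diff1 \<subseteq> {p. invertible (T p)}" using key by blast
  show "\<And>g. g \<in> carrier Irr_diff1 \<Longrightarrow>
      (M1 g ** matrix_inv (psd_sqrt (T g)), M2 g ** matrix_inv (psd_sqrt (T g))) = Irr_inv g" using key by blast
qed

lemma lie_group_Irr: "lie_group Irr_diff1"
  unfolding lie_group_def
proof (intro conjI)
  show "group Irr_diff1" by (rule group_Irr)
  have "continuous_on UNIV (\<lambda>g :: 1 pmod. fst g $ 1 $ 1)" "continuous_on UNIV (\<lambda>g :: 1 pmod. snd g $ 1 $ 1)"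
    by (intro continuous_intros)+
  then have "open {g :: 1 pmod. fst g $ 1 $ 1 \<noteq> 0 \<and> snd g $ 1 $ 1 \<noteq> 0}"
    by (intro open_Collect_conj open_Collect_neq continuous_on_const)
  then show "\<exists>k. embedded_submanifold k (carrier Irr_diff1)"
    using embedded_submanifold_P_modules[where 'n = 1] embedded_submanifold_open_Int
    unfolding carrier_Irr_eq by blast
  have "smooth_map (carrier Irr_diff1 \<times> carrier Irr_diff1) (\<lambda>(g, h). unit_tensor g h)"
    by (rule smooth_map_subset[OF smooth_unit_tensor]) (auto simp: carrier_Irr_eq)
  then show "smooth_map (carrier Irr_diff1 \<times> carrier Irr_diff1) (\<lambda>(g, h). monoid.mult Irr_diff1 g h)"
    by (simp add: Irr_simps)
  show "smooth_map (carrier Irr_diff1) (\<lambda>g. m_inv Irr_diff1 g)"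
    by (rule smooth_map_cong[OF _ smooth_Irr_inv]) (simp add: inv_Irr)
qed

lemma lie_group_action_P_modules: "lie_group_action Irr_diff1 (P_modules :: 'n::finite pmod set) P_action"
  unfolding lie_group_action_def
proof (intro conjI lie_group_Irr embedded_submanifold_P_modules group_action_P)
  show "smooth_map (carrier Irr_diff1 \<times> (P_modules :: 'n pmod set)) (\<lambda>(g, X). P_action g X)"
    by (rule smooth_map_cong[OF _ smooth_unit_tensor]) (auto simp: P_action_def)
qed

theorem corollary3p2:
  shows "lie_group_action Irr_diff1 (P_modules :: 'n::finite pmod set) P_action \<and>
    (\<forall>a b. \<forall>(A :: 'n cmat) B K.
       (mat a, mat b) \<in> carrier Irr_diff1 \<and> (A, B) \<in> P_modules \<and>
       K = psd_sqrt ((cmod a)\<^sup>2 *\<^sub>R (mabs A ** mabs A) + (cmod b)\<^sup>2 *\<^sub>R (mabs B ** mabs B)) \<longrightarrow>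
         tensor_defined (mat a :: 1 cmat, mat b :: 1 cmat) (A, B) \<and> invertible K \<and>
         P_action (mat a, mat b) (A, B) = unit_tensor (mat a, mat b) (A, B) \<and>
         unit_tensor (mat a, mat b) (A, B) =
           (mat a ** A ** matrix_inv K, mat b ** B ** matrix_inv K)) \<and>
    (\<forall>a b. \<forall>(A :: 'n cmat) B U\<^sub>A U\<^sub>B. \<forall>arg :: complex \<Rightarrow> real.
       (mat a, mat b) \<in> carrier Irr_diff1 \<and> (A, B) \<in> P_modules \<and>
       polar_unitary A U\<^sub>A \<and> polar_unitary B U\<^sub>B \<and> (\<forall>z. z \<noteq> 0 \<longrightarrow> is_Arg z (arg z)) \<longrightarrow>
         star_defined (mat (of_real (cmod a)) :: 1 cmat) (mabs A) \<and>
         star_defined (mat (of_real (cmod b)) :: 1 cmat) (mabs B) \<and>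
         P_action (mat a, mat b) (A, B) =
           (mat (exp (\<i> * of_real (arg a))) ** U\<^sub>A ** scalar_star (cmod a) (mabs A),
            mat (exp (\<i> * of_real (arg b))) ** U\<^sub>B ** scalar_star (cmod b) (mabs B))) \<and>
    group_action Irr_diff1 (M_modules :: 'n pmod set) (\<lambda>g. restrict (P_action g) M_modules) \<and>
    group_action Irr_diff1 (N_modules :: 'n pmod set) (\<lambda>g. restrict (P_action g) N_modules)"
proof (intro conjI lie_group_action_P_modules group_action_M group_action_N allI impI; elim conjE)
  fix a b and A B K :: "'n cmat"
  assume "(mat a, mat b) \<in> carrier Irr_diff1" and AB: "(A, B) \<in> P_modules"
    and "K = psd_sqrt ((cmod a)\<^sup>2 *\<^sub>R (mabs A ** mabs A) + (cmod b)\<^sup>2 *\<^sub>R (mabs B ** mabs B))"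
  then have nz: "a \<noteq> 0" "b \<noteq> 0" and K: "K = gram_root a b A B"
    by (simp_all add: carrier_Irr_iff gram_def mabs scaleR_conv_mat)
  show "tensor_defined (mat a :: 1 cmat, mat b :: 1 cmat) (A, B)" using AB nz by (rule tensor_defined_unit)
  show "invertible K" unfolding K using AB nz by (rule gram_root)
  show "P_action (mat a, mat b) (A, B) = unit_tensor (mat a, mat b) (A, B)"
    using AB by (simp add: P_action_def)
  show "unit_tensor (mat a, mat b) (A, B) = (mat a ** A ** matrix_inv K, mat b ** B ** matrix_inv K)"
    unfolding K using AB nz by (rule unit_tensor_eq)
next
  fix a b and A B U\<^sub>A U\<^sub>B :: "'n cmat" and arg :: "complex \<Rightarrow> real"
  assume "(mat a, mat b) \<in> carrier Irr_diff1" and AB: "(A, B) \<in> P_modules"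
    and U: "polar_unitary A U\<^sub>A" "polar_unitary B U\<^sub>B" and arg: "\<forall>z. z \<noteq> 0 \<longrightarrow> is_Arg z (arg z)"
  then have ab: "(cmod a)\<^sup>2 + (cmod b)\<^sup>2 = 1" and nz: "a \<noteq> 0" "b \<noteq> 0"
    by (simp_all add: carrier_Irr_iff)
  note BA = P_modules_swap[OF AB]
  have ba: "(cmod b)\<^sup>2 + (cmod a)\<^sup>2 = 1" using ab by simp
  show "star_defined (mat (of_real (cmod a)) :: 1 cmat) (mabs A)" by (rule star_defined_mabs[OF AB ab nz])
  show "star_defined (mat (of_real (cmod b)) :: 1 cmat) (mabs B)" by (rule star_defined_mabs[OF BA ba nz(2,1)])
  show "P_action (mat a, mat b) (A, B) =
      (mat (exp (\<i> * of_real (arg a))) ** U\<^sub>A ** scalar_star (cmod a) (mabs A),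
       mat (exp (\<i> * of_real (arg b))) ** U\<^sub>B ** scalar_star (cmod b) (mabs B))"
    using AB arg nz polar_scalar_star[OF AB ab nz U(1)] polar_scalar_star[OF BA ba nz(2,1) U(2)]
    by (simp add: P_action_def unit_tensor_eq gram_swap[of b a B A])
qed

end
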